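(* For every integer $k \geq 1$, let $\omega_k$ be the largest integer such that every error $\mathbf{e} \in \mathbb{F}_2^{E_k}$ of Hamming weight at most $\omega_k$ is decoded correctly by the renormalisation decoder on $\mathbf{T}_k$. Then $\omega_k \geq \left(\tfrac{6}{5}\right)^{k-1} - 1$. (Equivalently, since $d = 2^k$ is the minimum distance, every error of weight less than $\tfrac{5}{6} d^{\log_2(6/5)}$ is decoded correctly.)
   Context: Toric code and decoding. Fix an integer $k \geq 1$. Let $\mathbf{T}_k=(V_k,E_k)$ be the Cayley graph of $\mathbb{Z}/2^k\mathbb{Z}\times\mathbb{Z}/2^k\mathbb{Z}$ with generators $(\pm1,0),(0,\pm1)$ (a square tiling of a torus), with $n=|E_k| = 2\cdot 4^k$ edges. An error is a vector $\mathbf{e}\in\mathbb{F}_2^{E_k}$ (a set of edges); its syndrome $\sigma(\mathbf{e})$ is the set of vertices incident to an odd number of edges of $\mathbf{e}$. A decoder takes $\sigma(\mathbf{e})$ and outputs $\hat{\mathbf{e}}$ with $\sigma(\hat{\mathbf{e}})=\sigma(\mathbf{e})$; it decodes $\mathbf{e}$ correctly if $\mathbf{e}+\hat{\mathbf{e}}$ is a sum (mod 2) of faces (4-cycles $(x,y),(x+1,y),(x+1,y+1),(x,y+1)$) of $\mathbf{T}_k$, i.e. a homologically trivial cycle. The minimum distance of the code is $d=2^k$. Subtilings. For $0\le i\le k$ let $h_i=2^{k-i}$, let $V_i$ be the subgroup generated by $(h_i,0),(0,h_i)$, and let $\mathbf{T}_i$ be the graph on $V_i$ joining vertices differing by $\pm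 h_i$ in exactly one coordinate; each edge of $\mathbf{T}_i$ is identified with the corresponding straight path of length $h_i$ in $\mathbf{T}_k$, and "flipping" an edge of $\mathbf{T}_i$ means adding (mod 2) all edges of that path. For $i \ge 1$, a cell of $\mathbf{T}_i$ is a face of $\mathbf{T}_i$: with $h=h_i$, its vertices are $\alpha=(x,y)$ (top-left), $\beta=(x+h,y)$ (top-right), $\gamma=(x,y-h)$ (bottom-left), $\delta=(x+h,y-h)$ (bottom-right), and its edges are $t=\alpha\beta$, $b=\gamma\delta$, $l=\alpha\gamma$, $r=\beta\delta$. A block of $\mathbf{T}_i$ is a cell of $\mathbf{T}_{i-1}$, i.e. a square of side $2h$ whose top-left corner lies in $V_{i-1}$; it consists of four cells of $\mathbf{T}_i$: $A$ (top-left), $B$ (top-right), $C$ (bottom-left), $D$ (bottom-right). Reduction procedure on $\mathbf{T}_i$ (input $S\subseteq V_i$; output $\hat{\mathbf{e}}_i$, initially $0$). In each step all tests use the set $S$ as it is at the start of that step, and all blocks are treated simultaneously. Step 1: in the $D$ cell of every block, if $\alpha,\delta\in S$ flip $l$ and $b$; if $\beta,\gamma\in S$ flip $b$ and $r$ (if all four are in $S$, the net effect is to flip only $l$ and $r$); then remove all vertices so paired from $S$. Step 2: in the $C$ cell of every block, if $\alpha,\gamma\in S$ flip $l$, and if $\beta,\delta\in S$ flip $r$; in the $B$ cell of every block, if $\alpha,\beta\in S$ flip $t$, and if $\gamma,\delta\in S$ flip $b$; then remove all vertices so paired from $S$. Step 3: in the $A$ cell of every block, if $\beta\in S$ flip $t$;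 if $\gamma\in S$ flip $l$; if $\delta\in S$ flip $l$ and $b$. Renormalisation decoder. Start with $\hat{\mathbf{e}}=0$, $S=\sigma(\mathbf{e})$, $i=k$; while $S\neq\emptyset$ and $i>0$: run the reduction procedure on $\mathbf{T}_i$ with input $S$ to get $\hat{\mathbf{e}}_i$, set $\hat{\mathbf{e}}\gets\hat{\mathbf{e}}+\hat{\mathbf{e}}_i$, $S\gets S\,\triangle\,\sigma(\hat{\mathbf{e}}_i)$, $i\gets i-1$. Output $\hat{\mathbf{e}}$. *)

theory Defs
  imports Complex_Main
begin

text \<open>Vertices of the torus T_k are pairs (x,y) of integers with 0 <= x,y < 2^k
  (representatives of Z/2^k x Z/2^k).  An edge of T_k is a pair (v,d): d = 0 is the
  horizontal edge from v to v+(1,0), d = 1 the vertical edge from v to v+(0,1).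
  The y-coordinate grows "upwards" (top = larger y), as in the paper's cells.\<close>

type_synonym vert = "int \<times> int"
type_synonym edge = "vert \<times> nat"

definition NN :: "nat \<Rightarrow> int" where
  "NN k = 2 ^ k"

definition nrm :: "nat \<Rightarrow> vert \<Rightarrow> vert" where
  "nrm k v = (fst v mod NN k, snd v mod NN k)"

definition verts :: "nat \<Rightarrow> vert set" where
  "verts k = {v. 0 \<le> fst v \<and> fst v < NN k \<and> 0 \<le> snd v \<and> snd v < NN k}"

definition edges :: "nat \<Rightarrow> edge set" where
  "edges k = verts k \<times> {0, 1}"

definition shift :: "nat \<Rightarrow> vert \<Rightarrow> nat \<Rightarrow> int \<Rightarrow> vert" where
  "shift k v d j = nrm k (if d = 0 then (fst v + j, snd v) else (fst v, snd v + j))"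

definition ends :: "nat \<Rightarrow> edge \<Rightarrow> vert set" where
  "ends k f = {fst f, shift k (fst f) (snd f) 1}"

definition syndrome :: "nat \<Rightarrow> edge set \<Rightarrow> vert set" where
  "syndrome k e = {v \<in> verts k. odd (card {f \<in> e. v \<in> ends k f})}"

definition symdiff :: "'a set \<Rightarrow> 'a set \<Rightarrow> 'a set" where
  "symdiff A B = (A - B) \<union> (B - A)"

definition face :: "nat \<Rightarrow> vert \<Rightarrow> edge set" where
  "face k v = {(v, 0), (shift k v 0 1, 1), (shift k v 1 1, 0), (v, 1)}"

text \<open>Sums (mod 2) of faces, i.e. homologically trivial cycles.\<close>
inductive_set face_span :: "nat \<Rightarrow> edge set set" for k where
  zero: "{} \<in> face_span k"
| add: "A \<in> face_span k \<Longrightarrow> v \<in> verts k \<Longrightarrow> symdiff A (face k v) \<in> face_span k"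

definition hh :: "nat \<Rightarrow> nat \<Rightarrow> int" where
  "hh k i = 2 ^ (k - i)"

text \<open>An edge (v,d) of T_i (v in V_i) is identified with the straight path of length h
  in T_k starting at v in direction d.\<close>
definition tpath :: "nat \<Rightarrow> int \<Rightarrow> edge \<Rightarrow> edge set" where
  "tpath k h g = {(shift k (fst g) (snd g) j, snd g) | j. 0 \<le> j \<and> j < h}"

text \<open>Corners of the cell of side h with top-left corner c.\<close>
definition c\<alpha> :: "vert \<Rightarrow> vert" where "c\<alpha> c = c"
definition c\<beta> :: "nat \<Rightarrow> int \<Rightarrow> vert \<Rightarrow> vert" where "c\<beta> k h c = nrm k (fst c + h, snd c)"
definition c\<gamma> :: "nat \<Rightarrow> int \<Rightarrow> vert \<Rightarrow> vert" where "c\<gamma> k h c = nrm k (fst c, snd c - h)"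
definition c\<delta> :: "nat \<Rightarrow> int \<Rightarrow> vert \<Rightarrow> vert" where "c\<delta> k h c = nrm k (fst c + h, snd c - h)"

text \<open>Edges of that cell, as edges of T_i: t = alpha beta, b = gamma delta,
  l = alpha gamma, r = beta delta.\<close>
definition Et :: "nat \<Rightarrow> int \<Rightarrow> vert \<Rightarrow> edge" where "Et k h c = (c\<alpha> c, 0)"
definition Eb :: "nat \<Rightarrow> int \<Rightarrow> vert \<Rightarrow> edge" where "Eb k h c = (c\<gamma> k h c, 0)"
definition El :: "nat \<Rightarrow> int \<Rightarrow> vert \<Rightarrow> edge" where "El k h c = (c\<gamma> k h c, 1)"
definition Er :: "nat \<Rightarrow> int \<Rightarrow> vert \<Rightarrow> edge" where "Er k h c = (c\<delta> k h c, 1)"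

text \<open>Top-left corners of the blocks of T_i: the vertices of V_{i-1}.\<close>
definition blocks :: "nat \<Rightarrow> int \<Rightarrow> vert set" where
  "blocks k h = {v \<in> verts k. (2 * h) dvd fst v \<and> (2 * h) dvd snd v}"

definition cellA :: "vert \<Rightarrow> vert" where "cellA x = x"
definition cellB :: "nat \<Rightarrow> int \<Rightarrow> vert \<Rightarrow> vert" where "cellB k h x = c\<beta> k h x"
definition cellC :: "nat \<Rightarrow> int \<Rightarrow> vert \<Rightarrow> vert" where "cellC k h x = c\<gamma> k h x"
definition cellD :: "nat \<Rightarrow> int \<Rightarrow> vert \<Rightarrow> vert" where "cellD k h x = c\<delta> k h x"

definition flips1 :: "nat \<Rightarrow> int \<Rightarrow> vert set \<Rightarrow> vert \<Rightarrow> edge list" where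
  "flips1 k h S x = (let c = cellD k h x in
     (if c\<alpha> c \<in> S \<and> c\<delta> k h c \<in> S then [El k h c, Eb k h c] else []) @
     (if c\<beta> k h c \<in> S \<and> c\<gamma> k h c \<in> S then [Eb k h c, Er k h c] else []))"

definition rem1 :: "nat \<Rightarrow> int \<Rightarrow> vert set \<Rightarrow> vert \<Rightarrow> vert set" where
  "rem1 k h S x = (let c = cellD k h x in
     (if c\<alpha> c \<in> S \<and> c\<delta> k h c \<in> S then {c\<alpha> c, c\<delta> k h c} else {}) \<union>
     (if c\<beta> k h c \<in> S \<and> c\<gamma> k h c \<in> S then {c\<beta> k h c, c\<gamma> k h c} else {}))"

definition S1 :: "nat \<Rightarrow> int \<Rightarrow> vert set \<Rightarrow> vert set" where
  "S1 k h S = S - (\<Union>x \<in> blocks k h. rem1 k h S x)"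

definition flips2 :: "nat \<Rightarrow> int \<Rightarrow> vert set \<Rightarrow> vert \<Rightarrow> edge list" where
  "flips2 k h S x = (let c = cellC k h x; c' = cellB k h x in
     (if c\<alpha> c \<in> S \<and> c\<gamma> k h c \<in> S then [El k h c] else []) @
     (if c\<beta> k h c \<in> S \<and> c\<delta> k h c \<in> S then [Er k h c] else []) @
     (if c\<alpha> c' \<in> S \<and> c\<beta> k h c' \<in> S then [Et k h c'] else []) @
     (if c\<gamma> k h c' \<in> S \<and> c\<delta> k h c' \<in> S then [Eb k h c'] else []))"

definition rem2 :: "nat \<Rightarrow> int \<Rightarrow> vert set \<Rightarrow> vert \<Rightarrow> vert set" where
  "rem2 k h S x = (let c = cellC k h x; c' = cellB k h x in
     (if c\<alpha> c \<in> S \<and> c\<gamma> k h c \<in> S then {c\<alpha> c, c\<gamma> k h c} else {}) \<union>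
     (if c\<beta> k h c \<in> S \<and> c\<delta> k h c \<in> S then {c\<beta> k h c, c\<delta> k h c} else {}) \<union>
     (if c\<alpha> c' \<in> S \<and> c\<beta> k h c' \<in> S then {c\<alpha> c', c\<beta> k h c'} else {}) \<union>
     (if c\<gamma> k h c' \<in> S \<and> c\<delta> k h c' \<in> S then {c\<gamma> k h c', c\<delta> k h c'} else {}))"

definition S2 :: "nat \<Rightarrow> int \<Rightarrow> vert set \<Rightarrow> vert set" where
  "S2 k h S = S - (\<Union>x \<in> blocks k h. rem2 k h S x)"

definition flips3 :: "nat \<Rightarrow> int \<Rightarrow> vert set \<Rightarrow> vert \<Rightarrow> edge list" where
  "flips3 k h S x = (let c = cellA x in
     (if c\<beta> k h c \<in> S then [Et k h c] else []) @
     (if c\<gamma> k h c \<in> S then [El k h c] else []) @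
     (if c\<delta> k h c \<in> S then [El k h c, Eb k h c] else []))"

text \<open>All T_i-edges flipped on behalf of the block with top-left corner x
  (each step uses the set S as it is at the start of that step).\<close>
definition flips :: "nat \<Rightarrow> int \<Rightarrow> vert set \<Rightarrow> vert \<Rightarrow> edge list" where
  "flips k h S x = flips1 k h S x @ flips2 k h (S1 k h S) x @
                   flips3 k h (S2 k h (S1 k h S)) x"

definition reduce :: "nat \<Rightarrow> nat \<Rightarrow> vert set \<Rightarrow> edge set" where
  "reduce k i S = (let h = hh k i in
     {f \<in> edges k. odd (\<Sum>x \<in> blocks k h. length (filter (\<lambda>g. f \<in> tpath k h g) (flips k h S x)))})"

fun dec_loop :: "nat \<Rightarrow> nat \<Rightarrow> vert set \<Rightarrow> edge set \<Rightarrow> edge set" where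
  "dec_loop k 0 S e = e"
| "dec_loop k (Suc j) S e =
     (if S = {} then e
      else (let ei = reduce k (Suc j) S in
            dec_loop k j (symdiff S (syndrome k ei)) (symdiff e ei)))"

definition decoder :: "nat \<Rightarrow> edge set \<Rightarrow> edge set" where
  "decoder k e = dec_loop k k (syndrome k e) {}"

definition decodes_correctly :: "nat \<Rightarrow> edge set \<Rightarrow> bool" where
  "decodes_correctly k e \<longleftrightarrow> symdiff e (decoder k (e)) \<in> face_span k"

definition omega :: "nat \<Rightarrow> int" where
  "omega k = (GREATEST w :: int. \<forall>e \<subseteq> edges k. int (card e) \<le> w \<longrightarrow> decodes_correctly k e)"

end

theory Submission
  imports Defs "HOL-Library.Z2" "HOL-Library.Function_Algebras" "HOL-Library.Product_Plus"
begin

text \<open>The vertices of T_i are partitioned by the A cells, which step 3 contracts, and also by the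
  D cells. All pairs matched in steps 1 and 2 lie in one D cell, and a D cell keeps at most one unmatched
  vertex. Hence the edges of an error F on T_i together with the matched pairs (``jumps'')
  decompose into closed trails and into open trails joining unmatched vertices.
  A trail with N moves is homologous, after contraction, to a path of T_(i-1) whose length D is the
  l1-displacement of its ends; one has 6 D \<le> 5 N, and 6 D \<le> 5 N - 1 for open trails, because a
  diagonal jump that advances D by two can only be repeated after two edges that do not advance it.
  Summing over all trails, the potential 2 |F| + |S|, where S is the syndrome of F, drops by a
  factor 5/6 in every reduction. It is at most 4 |F| initially, and at T_1 a value below 4
  forces F to be empty.\<close>

section \<open>Chains modulo 2\<close>

text \<open>The weights in 2 |F| + |S| make every move of a trail cost 2: an edge directly, a jump
  through the two syndrome vertices that it removes. An open trail costs 2 more for its unmatched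
  ends and leaves at most 2 D + 2 behind, so losing the factor 5/6 means 6 (2 D + 2) <= 5 (2 N + 2),
  that is 6 D <= 5 N - 1. Short open trails set this ratio: edge, edge, diagonal jump, edge, edge
  can reach D = 4 with N = 5, which is equality, whereas a long alternation of diagonal jumps and
  pairs of edges only gains D = 2 per N = 3. The obstacle is that D is a planar quantity, while
  trails live on a torus and a closed one may wind around it. So trails are lifted to Z^2. The lift
  is consistent because A cells, D cells and jumps depend on parities only, and the period 2^i of
  T_i is even for i >= 1.\<close>

definition ind :: "'a set \<Rightarrow> 'a \<Rightarrow> bit" where
  "ind A = (\<lambda>x. of_bool (x \<in> A))"

lemma ind_eq_1_iff [simp]: "ind A x = 1 \<longleftrightarrow> x \<in> A"
  by (simp add: ind_def)

lemma ind_support: "ind {x. c x = 1} = c"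
proof
  fix x show "ind {x. c x = 1} x = c x"
    by (cases "c x") (simp_all add: ind_def)
qed

lemma ind_inject: "ind A = ind B \<longleftrightarrow> A = B"
  by (metis ind_eq_1_iff subsetI subset_antisym)

lemma ind_empty [simp]: "ind {} = 0"
  by (simp add: ind_def fun_eq_iff)

lemma add_self [simp]: "(c :: 'a \<Rightarrow> bit) + c = 0"
  by (simp add: fun_eq_iff)

lemma add_self_left [simp]: "(c :: 'a \<Rightarrow> bit) + (c + d) = d"
  by (simp add: fun_eq_iff flip: add.assoc)

lemma add_eq_0_char2: "(a :: 'a \<Rightarrow> bit) + b = 0 \<Longrightarrow> a = b"
  using add_self_left[of a b] by simp

lemmas char2 = add.assoc add.commute add.left_commute

lemma ind_symdiff: "ind (symdiff A B) = ind A + ind B"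
  by (auto simp: ind_def symdiff_def fun_eq_iff)

lemma ind_disjoint_Un: "A \<inter> B = {} \<Longrightarrow> ind (A \<union> B) = ind A + ind B"
  by (auto simp: ind_def fun_eq_iff)

lemma ind_insert: "x \<notin> A \<Longrightarrow> ind (insert x A) = ind {x} + ind A"
  by (auto simp: ind_def fun_eq_iff)

lemma sum_fun_apply: "(\<Sum>a\<in>A. f a) x = (\<Sum>a\<in>A. f a x :: bit)"
  by (induction A rule: infinite_finite_induct) auto

lemma sum_list_fun_apply: "(\<Sum>a\<leftarrow>as. f a) x = (\<Sum>a\<leftarrow>as. f a x :: bit)"
  by (induction as) auto

lemma of_nat_bit: "(of_nat n :: bit) = of_bool (odd n)"
  by (induction n) auto

lemma ind_eq_sum: "finite A \<Longrightarrow> ind A = (\<Sum>a\<in>A. ind {a})"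
proof (induction A rule: finite_induct)
  case (insert x F)
  show ?case
    unfolding sum.insert[OF insert.hyps] insert.IH[symmetric] by (rule ind_insert[OF insert.hyps(2)])
qed simp

lemma sum_symdiff:
  fixes f :: "'a \<Rightarrow> 'b \<Rightarrow> bit"
  assumes "finite A" "finite B"
  shows "(\<Sum>x\<in>symdiff A B. f x) = (\<Sum>x\<in>A. f x) + (\<Sum>x\<in>B. f x)"
proof -
  have "(\<Sum>x\<in>A. f x) = (\<Sum>x\<in>A - B. f x) + (\<Sum>x\<in>A \<inter> B. f x)"
    using assms by (metis Diff_Diff_Int Diff_subset add.commute sum.subset_diff)
  moreover have "(\<Sum>x\<in>B. f x) = (\<Sum>x\<in>B - A. f x) + (\<Sum>x\<in>A \<inter> B. f x)"
    using assms by (metis Diff_Diff_Int Diff_subset Int_commute add.commute sum.subset_diff)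
  moreover have "(\<Sum>x\<in>symdiff A B. f x) = (\<Sum>x\<in>A - B. f x) + (\<Sum>x\<in>B - A. f x)"
    unfolding symdiff_def using assms by (intro sum.union_disjoint) auto
  ultimately show ?thesis by (simp add: char2)
qed

(* Higher-order unification eta-expands chains, and simp would then turn sums of chains into
   pointwise xor expressions. *)
declare plus_fun_apply [simp del] zero_fun_apply [simp del]

section \<open>Null-homologous chains\<close>

text \<open>\<open>face_span\<close> consists of edge sets; passing to supports transfers it to
  chains, where homologies compose by cancellation.\<close>

definition nullhom :: "nat \<Rightarrow> (edge \<Rightarrow> bit) \<Rightarrow> bool" where
  "nullhom k c \<longleftrightarrow> {f. c f = 1} \<in> face_span k"

lemma nullhom_ind: "nullhom k (ind A) \<longleftrightarrow> A \<in> face_span k"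
  by (simp add: nullhom_def)

lemma nullhom_0 [simp]: "nullhom k 0"
  by (simp add: nullhom_def zero_fun_apply face_span.zero)

lemma nullhom_face: "v \<in> verts k \<Longrightarrow> nullhom k (ind (face k v))"
  using face_span.add[OF face_span.zero, of v k] by (simp add: nullhom_ind symdiff_def)

lemma nullhom_add:
  assumes "nullhom k a" "nullhom k b"
  shows "nullhom k (a + b)"
proof -
  have "symdiff A B \<in> face_span k" if "B \<in> face_span k" "A \<in> face_span k" for A B
    using that
  proof (induction B rule: face_span.induct)
    case zero
    then show ?case by (simp add: symdiff_def)
  next
    case (add B v)
    have "symdiff A (symdiff B (face k v)) = symdiff (symdiff A B) (face k v)"
      by (auto simp: symdiff_def)
    with add show ?case by (simp add: face_span.add)
  qed
  from this[OF assms(2)[unfolded nullhom_def] assms(1)[unfolded nullhom_def]]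
  show ?thesis
    by (metis ind_support ind_symdiff nullhom_ind)
qed

lemma nullhom_sum: "(\<And>x. x \<in> A \<Longrightarrow> nullhom k (f x)) \<Longrightarrow> nullhom k (\<Sum>x\<in>A. f x)"
  by (induction A rule: infinite_finite_induct) (auto intro: nullhom_add)

lemma nullhom_trans: "nullhom k (a + b) \<Longrightarrow> nullhom k (b + c) \<Longrightarrow> nullhom k (a + c)"
  using nullhom_add[of k "a + b" "b + c"] by (simp add: char2)

lemma nullhom_sum_cong:
  assumes "\<And>x. x \<in> A \<Longrightarrow> nullhom k (f x + g x)"
  shows "nullhom k ((\<Sum>x\<in>A. f x) + (\<Sum>x\<in>A. g x))"
  using nullhom_sum[of A k "\<lambda>x. f x + g x"] assms by (simp add: sum.distrib)

section \<open>The subtilings\<close>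

lemma NN_pos [simp]: "NN k > 0"
  by (simp add: NN_def)

lemma nrm_in_verts [simp]: "nrm k v \<in> verts k"
  by (simp add: nrm_def verts_def)

lemma nrm_id [simp]: "v \<in> verts k \<Longrightarrow> nrm k v = v"
  by (auto simp: nrm_def verts_def prod_eq_iff)

lemma verts_eq: "verts k = {0..<NN k} \<times> {0..<NN k}"
  by (auto simp: verts_def)

lemma finite_verts [simp]: "finite (verts k)"
  by (simp add: verts_eq)

lemma finite_edges [simp]: "finite (edges k)"
  by (simp add: edges_def)

lemma nrm_eq_iff:
  "nrm k v = nrm k w \<longleftrightarrow> NN k dvd fst v - fst w \<and> NN k dvd snd v - snd w"
  by (simp add: nrm_def mod_eq_dvd_iff)

definition dir :: "nat \<Rightarrow> vert" where
  "dir d = (if d = 0 then (1, 0) else (0, 1))"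

text \<open>Lattice coordinates for T_i: points are integer pairs, not residues, so that walks on
  the torus can be lifted to the plane.\<close>

definition pt :: "nat \<Rightarrow> nat \<Rightarrow> vert \<Rightarrow> vert" where
  "pt k i z = nrm k (hh k i * fst z, hh k i * snd z)"

definition seg :: "nat \<Rightarrow> nat \<Rightarrow> vert \<Rightarrow> nat \<Rightarrow> edge \<Rightarrow> bit" where
  "seg k i z d = ind (tpath k (hh k i) (pt k i z, d))"

lemma hh_pos [simp]: "hh k i > 0"
  by (simp add: hh_def)

lemma hh_NN: "i \<le> k \<Longrightarrow> hh k i * NN i = NN k"
  by (simp add: hh_def NN_def flip: power_add)

lemma hh_Suc: "i < k \<Longrightarrow> hh k i = 2 * hh k (Suc i)"
  by (simp add: hh_def Suc_diff_Suc flip: power_Suc)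

lemma hh_self [simp]: "hh k k = 1"
  by (simp add: hh_def)

lemma pt_eq_iff:
  assumes "i \<le> k"
  shows "pt k i z = pt k i w \<longleftrightarrow> nrm i z = nrm i w"
proof -
  have "NN k dvd hh k i * a - hh k i * b \<longleftrightarrow> NN i dvd a - b" for a b
    using hh_NN[OF assms] hh_pos[of k i]
    by (metis dvd_mult_cancel_left less_irrefl right_diff_distrib)
  then show ?thesis
    by (simp add: pt_def nrm_eq_iff)
qed

lemma pt_nrm [simp]: "i \<le> k \<Longrightarrow> pt k i (nrm i z) = pt k i z"
  by (simp add: pt_eq_iff)

lemma pt_in_verts [simp]: "pt k i z \<in> verts k"
  by (simp add: pt_def)

lemma pt_Suc: "i < k \<Longrightarrow> pt k i z = pt k (Suc i) (z + z)"
  by (simp add: pt_def hh_Suc algebra_simps)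

lemma shift_nrm:
  "shift k (nrm k v) d j = nrm k (if d = 0 then (fst v + j, snd v) else (fst v, snd v + j))"
  by (simp add: shift_def nrm_def mod_add_left_eq)

lemma seg_nrm [simp]: "i \<le> k \<Longrightarrow> seg k i (nrm i z) d = seg k i z d"
  by (simp add: seg_def)

lemma seg_cong: "i \<le> k \<Longrightarrow> nrm i z = nrm i w \<Longrightarrow> seg k i z d = seg k i w d"
  using seg_nrm by metis

lemma seg_self: "seg k k z d = ind {(nrm k z, d)}"
proof -
  have "0 \<le> j \<and> j < 1 \<longleftrightarrow> j = 0" for j :: int
    by auto
  then have "tpath k 1 (pt k k z, d) = {(nrm k z, d)}"
    by (simp add: tpath_def pt_def shift_nrm)
  then show ?thesis by (simp add: seg_def)
qed

text \<open>The path of length 2h is cut at its midpoint. The halves share no edge, so nothing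
  cancels modulo 2, because 2h is at most the circumference 2^k.\<close>

lemma seg_Suc:
  assumes "i < k"
  shows "seg k i z d = seg k (Suc i) (z + z) d + seg k (Suc i) (z + z + dir d) d"
proof -
  define h where "h = hh k (Suc i)"
  define P where "P j = (nrm k (if d = 0 then (2 * h * fst z + j, 2 * h * snd z)
                                else (2 * h * fst z, 2 * h * snd z + j)), d)" for j
  have h: "hh k i = 2 * h" "h > 0"
    using assms by (auto simp: h_def hh_Suc)
  have t0: "tpath k (hh k i) (pt k i z, d) = P ` {0..<2 * h}"
    by (auto simp: tpath_def pt_def shift_nrm P_def h image_iff)
  have t1: "tpath k h (pt k (Suc i) (z + z), d) = P ` {0..<h}"
    by (auto simp: tpath_def pt_def shift_nrm P_def image_iff algebra_simps simp flip: h_def)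
  have "tpath k h (pt k (Suc i) (z + z + dir d), d) = (\<lambda>j. P (h + j)) ` {0..<h}"
    by (auto simp: tpath_def pt_def shift_nrm P_def image_iff dir_def algebra_simps simp flip: h_def)
  also have "\<dots> = P ` {h..<2 * h}"
    unfolding image_image[symmetric, of P "\<lambda>j. h + j"] by simp
  finally have t2: "tpath k h (pt k (Suc i) (z + z + dir d), d) = P ` {h..<2 * h}" .
  have "2 * h \<le> NN k"
    using assms h(1) unfolding hh_def NN_def by (metis diff_le_self one_le_numeral power_increasing)
  moreover have "P j = P j' \<Longrightarrow> NN k dvd j - j'" for j j'
    by (auto simp: P_def nrm_eq_iff split: if_splits)
  moreover have "\<not> m dvd j - j'" if "0 \<le> j" "j < h" "h \<le> j'" "j' < 2 * h" "2 * h \<le> m" for m j j'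
    using that zdvd_imp_le[of m "j' - j"] by (auto simp: dvd_diff_commute)
  ultimately have "P j \<noteq> P j'" if "0 \<le> j" "j < h" "h \<le> j'" "j' < 2 * h" for j j'
    using that by blast
  then have "P ` {0..<h} \<inter> P ` {h..<2 * h} = {}"
    by fastforce
  moreover have "{0..<2 * h} = {0..<h} \<union> {h..<2 * h}"
    using h by auto
  then have "P ` {0..<2 * h} = P ` {0..<h} \<union> P ` {h..<2 * h}"
    by (simp only: image_Un)
  ultimately show ?thesis
    unfolding seg_def h_def[symmetric] t0 t1 t2 by (simp add: ind_disjoint_Un)
qed

definition square :: "nat \<Rightarrow> nat \<Rightarrow> vert \<Rightarrow> edge \<Rightarrow> bit" where
  "square k i z = seg k i z 0 + seg k i (z + dir 0) 1 + seg k i (z + dir 1) 0 + seg k i z 1"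

text \<open>The four interior edges belong to two small squares each and cancel; the eight outer
  ones make up the sides of the large square.\<close>

lemma square_Suc:
  assumes "i < k"
  shows "square k i z = square k (Suc i) (z + z) + square k (Suc i) (z + z + dir 0)
           + square k (Suc i) (z + z + dir 1) + square k (Suc i) (z + z + dir 0 + dir 1)"
  unfolding square_def seg_Suc[OF assms] by (simp only: char2 add_self add_self_left)

lemma nrm_dir_neq:
  assumes "1 \<le> k"
  shows "nrm k z \<noteq> nrm k (z + dir d)"
proof -
  have "2 \<le> NN k"
    using assms by (simp add: NN_def self_le_power)
  then have "\<not> NN k dvd 1"
    using zdvd_not_zless[of 1 "NN k"] by simp
  then show ?thesis
    by (simp add: nrm_eq_iff dir_def)
qed

lemma ind_face:
  assumes "1 \<le> k"
  shows "ind (face k (nrm k z)) = square k k z"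
proof -
  have "face k (nrm k z) =
      {(nrm k z, 0), (nrm k (z + dir 0), 1), (nrm k (z + dir 1), 0), (nrm k z, 1)}"
    by (simp add: face_def shift_nrm dir_def plus_prod_def)
  also have "ind \<dots> = ind {(nrm k z, 0)} + (ind {(nrm k (z + dir 0), 1)} +
      (ind {(nrm k (z + dir 1), 0)} + ind {(nrm k z, 1)}))"
    using nrm_dir_neq[OF assms, of z 0] nrm_dir_neq[OF assms, of z 1] by (subst ind_eq_sum) simp_all
  finally show ?thesis
    unfolding square_def seg_self by (simp only: add.assoc)
qed

text \<open>Descending induction: on T_k a square is a face, and a coarser square is a sum of four
  finer ones.\<close>

lemma nullhom_square:
  assumes "1 \<le> k" "i \<le> k"
  shows "nullhom k (square k i z)"
  using assms(2)
proof (induction i arbitrary: z rule: inc_induct)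
  case base
  show ?case
    using nullhom_face[OF nrm_in_verts, of k z] by (simp only: ind_face[OF assms(1)])
next
  case (step n)
  show ?case
    unfolding square_Suc[OF step.hyps(2)] by (intro nullhom_add step.IH)
qed

section \<open>Walks made of edges and jumps\<close>

text \<open>Named copies of division and remainder by 2, so that arithmetic treats them as atoms;
  \<open>half_rmd_simps\<close> makes unit shifts and reflections linear in them.\<close>

definition half :: "int \<Rightarrow> int" where "half x = x div 2"

definition rmd :: "int \<Rightarrow> int" where "rmd x = x mod 2"

lemma half_rmd_simps:
  "half (x + 1) = half x + rmd x" "rmd (x + 1) = 1 - rmd x"
  "half (x - 1) = half x + rmd x - 1" "rmd (x - 1) = 1 - rmd x"
  "half (- x) = - half x - rmd x" "rmd (- x) = rmd x"
  "half (1 - x) = - half x" "rmd (1 - x) = 1 - rmd x"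
  unfolding half_def rmd_def by presburger+

lemma rmd_cases: "rmd x = 0 \<or> rmd x = 1"
  unfolding rmd_def by presburger

definition adj :: "vert \<Rightarrow> vert \<Rightarrow> bool" where
  "adj z w \<longleftrightarrow> \<bar>fst w - fst z\<bar> + \<bar>snd w - snd z\<bar> = 1"

text \<open>D cells pair the x-coordinates 2a - 1, 2a and the y-coordinates 2b, 2b + 1. A cells use
  the complementary pairings; twice \<open>par z\<close> is the top-left corner of the A cell of
  z.\<close>

definition same_D :: "vert \<Rightarrow> vert \<Rightarrow> bool" where
  "same_D z w \<longleftrightarrow> half (fst z + 1) = half (fst w + 1) \<and> half (snd z) = half (snd w)"

definition par :: "vert \<Rightarrow> vert" where
  "par z = (half (fst z), half (snd z + 1))"

definition dist_par :: "vert \<Rightarrow> vert \<Rightarrow> int" where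
  "dist_par z w = \<bar>fst (par w) - fst (par z)\<bar> + \<bar>snd (par w) - snd (par z)\<bar>"

text \<open>The four reflections preserving the A cells and the D cells; the l1-displacement of a walk
  is its largest gain of height over all charts.\<close>

definition charts :: "((int \<Rightarrow> int) \<times> (int \<Rightarrow> int)) set" where
  "charts = {\<lambda>x. x, \<lambda>x. 1 - x} \<times> {\<lambda>y. y + 1, \<lambda>y. - y}"

definition odds :: "(int \<Rightarrow> int) \<times> (int \<Rightarrow> int) \<Rightarrow> vert \<Rightarrow> int" where
  "odds c z = rmd (fst c (fst z)) + rmd (snd c (snd z))"

definition height :: "(int \<Rightarrow> int) \<times> (int \<Rightarrow> int) \<Rightarrow> vert \<Rightarrow> int" where
  "height c z = half (fst c (fst z)) + half (snd c (snd z))"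

lemma odds_cases: "odds c z = 0 \<or> odds c z = 1 \<or> odds c z = 2"
  using rmd_cases[of "fst c (fst z)"] rmd_cases[of "snd c (snd z)"] unfolding odds_def by auto

text \<open>\<open>height\<close> plus \<open>odds\<close> is constant on a D cell, since half x +
  rmd x = half (x + 1). So a move inside a D cell gains at most two, and gains two only on the
  diagonal from \<open>odds\<close> 2 to \<open>odds\<close> 0.\<close>

lemma height_same_D:
  assumes "c \<in> charts" "same_D z w"
  shows "height c w - height c z = odds c z - odds c w"
  using assms by (auto simp: charts_def height_def odds_def same_D_def half_rmd_simps)

text \<open>An edge changes one parity. In that coordinate its ends form either an A pair, which has
  one parent, or a D pair, and then both ends lie in one D cell because the other coordinate is
  fixed.\<close>

lemma height_adj:
  assumes "c \<in> charts" "adj z w"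
  shows "\<bar>odds c w - odds c z\<bar> = 1" "height c w = height c z \<or> same_D z w"
proof -
  have "fst w = fst z + 1 \<and> snd w = snd z \<or> fst w = fst z - 1 \<and> snd w = snd z \<or>
      fst w = fst z \<and> snd w = snd z + 1 \<or> fst w = fst z \<and> snd w = snd z - 1"
    using assms(2) unfolding adj_def by linarith
  then show "\<bar>odds c w - odds c z\<bar> = 1" "height c w = height c z \<or> same_D z w"
    using assms(1) rmd_cases[of "fst z"] rmd_cases[of "snd z"]
    unfolding charts_def odds_def height_def same_D_def
    by (auto simp only: half_rmd_simps insert_iff empty_iff mem_Times_iff fst_conv snd_conv; simp add: half_rmd_simps)+
qed

text \<open>The flag says that no jump may follow: the last move was a jump, or no move was made.\<close>

inductive walk :: "vert \<Rightarrow> vert \<Rightarrow> nat \<Rightarrow> bool \<Rightarrow> bool" for z0 where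
  start: "walk z0 z0 0 True"
| edge: "walk z0 z n j \<Longrightarrow> adj z w \<Longrightarrow> walk z0 w (Suc n) False"
| jump: "walk z0 z n False \<Longrightarrow> same_D z w \<Longrightarrow> walk z0 w (Suc n) True"

text \<open>The excess 6 D - 5 N of a walk obeys this bound, given the number m of odd coordinates of its
  end point, except after one or two edges inside the D cell where the walk starts. The values
  are the optimum of a longest-path problem on the states (j, m).\<close>

definition excess_bound :: "bool \<Rightarrow> int \<Rightarrow> int" where
  "excess_bound j m = (if j then (if m = 0 then 3 else if m = 1 then - 3 else - 9)
                       else (if m = 0 then - 1 else if m = 1 then - 2 else - 4))"

text \<open>The last alternative is the exceptional start: edges inside the first D cell gain height
  at once, with excess 6 - 5 = 1 after one edge and 2 after two. It feeds the table: from excess 1,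
  an A edge to two odd coordinates gives the entry -4, and a diagonal jump from there gives the
  entry 3. The initial flag forbids an immediate jump, whose excess could be 12 - 5 = 7.\<close>

lemma walk_excess:
  assumes "c \<in> charts" "walk z0 z n j"
  defines "g \<equiv> 6 * (height c z - height c z0) - 5 * int n"
  shows "n = 0 \<and> j \<and> z = z0 \<or> g \<le> excess_bound j (odds c z) \<or>
    \<not> j \<and> same_D z0 z \<and> (odds c z \<le> 1 \<and> g \<le> 1 \<or> odds c z = 0 \<and> g \<le> 2)"
  using assms(2) unfolding g_def
proof (induction rule: walk.induct)
  case start
  then show ?case by simp
next
  case (edge z n j w)
  note h = height_adj[OF assms(1) edge.hyps(2)] height_same_D[OF assms(1), of z w]
  have tr: "same_D z0 z \<Longrightarrow> same_D z w \<Longrightarrow> same_D z0 w" "same_D z0 z0"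
    by (auto simp: same_D_def)
  show ?case
    using edge.IH h tr odds_cases[of c z] odds_cases[of c w]
    unfolding excess_bound_def by (smt (z3) of_nat_Suc of_nat_0)
next
  case (jump z n w)
  \<comment> \<open>The table for walks ending with an edge, merged with the exceptional values 2
    and 1: all that a jump can start from.\<close>
  have "6 * (height c z - height c z0) - 5 * int n \<le>
      (if odds c z = 0 then 2 else if odds c z = 1 then 1 else - 4)"
    using jump.IH odds_cases[of c z] by (auto simp: excess_bound_def split: if_splits)
  then have "6 * (height c w - height c z0) - 5 * int (Suc n) \<le> excess_bound True (odds c w)"
    using height_same_D[OF assms(1) jump.hyps(2)] odds_cases[of c z] odds_cases[of c w]
    by (auto simp: excess_bound_def)
  then show ?case
    by blast
qed

text \<open>|p| + |q| is the largest of the four signed sums of p and q, and for the displacement of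
  the parents these sums are the height differences in the four charts.\<close>

lemma dist_par_le:
  assumes "\<And>c. c \<in> charts \<Longrightarrow> a * (height c w - height c z) \<le> m"
  shows "a * dist_par z w \<le> m"
proof -
  have abs: "a * (\<bar>p\<bar> + \<bar>q\<bar>) \<le> m"
    if "a * (p + q) \<le> m" "a * (p - q) \<le> m" "a * (- p + q) \<le> m" "a * (- p - q) \<le> m" for p q :: int
    using that by (cases "p \<ge> 0"; cases "q \<ge> 0") simp_all
  show ?thesis
    using assms[of "(\<lambda>x. x, \<lambda>y. y + 1)"] assms[of "(\<lambda>x. x, \<lambda>y. - y)"]
      assms[of "(\<lambda>x. 1 - x, \<lambda>y. y + 1)"] assms[of "(\<lambda>x. 1 - x, \<lambda>y. - y)"]
    unfolding charts_def height_def dist_par_def par_def fst_conv snd_conv half_rmd_simps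
    by (intro abs) (simp_all add: algebra_simps)
qed

text \<open>Ending outside the first D cell rules out the exceptional alternative of
  \<open>walk_excess\<close>, and every table entry for a walk that ends with an edge is at most
  -1.\<close>

lemma open_walk_bound:
  assumes "walk z0 z n False" "\<not> same_D z0 z"
  shows "6 * dist_par z0 z \<le> 5 * int n - 1"
proof (rule dist_par_le)
  fix c assume c: "c \<in> charts"
  show "6 * (height c z - height c z0) \<le> 5 * int n - 1"
    using walk_excess[OF c assms(1)] assms(2) by (auto simp: excess_bound_def split: if_splits)
qed

section \<open>Closed trails: walks with no restriction on jumps\<close>

inductive free_walk :: "vert \<Rightarrow> vert \<Rightarrow> nat \<Rightarrow> bool" for z0 where
  start: "free_walk z0 z0 0"
| step: "free_walk z0 z n \<Longrightarrow> adj z w \<or> same_D z w \<Longrightarrow> free_walk z0 w (Suc n)"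

text \<open>Four per odd coordinate is a potential that absorbs each move: a move inside a D cell
  with gain m <= 2 has 6 m - 5 <= 4 m, and an edge inside an A cell has -5 against a change of 4.
  Around a closed trail the potential cancels, so consecutive jumps do no harm.\<close>

lemma free_walk_excess:
  assumes "c \<in> charts" "free_walk z0 z n"
  shows "6 * (height c z - height c z0) - 5 * int n \<le> 4 * odds c z0 - 4 * odds c z"
  using assms(2)
proof (induction rule: free_walk.induct)
  case (step z n w)
  have "height c w - height c z = odds c z - odds c w \<or>
      height c w = height c z \<and> \<bar>odds c w - odds c z\<bar> = 1"
    using step.hyps(2) height_adj[OF assms(1), of z w] height_same_D[OF assms(1), of z w] by blast
  then have "6 * (height c w - height c z) - 5 \<le> 4 * odds c z - 4 * odds c w"
    using odds_cases[of c z] odds_cases[of c w] by auto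
  with step.IH show ?case by simp
qed simp

text \<open>Closed means closed on the torus: the ends of the lift may differ by a period, so the
  distance need not be 0, but periods are even and \<open>odds\<close> agrees at both ends.\<close>

lemma closed_walk_bound:
  assumes "free_walk z0 z n" "even (fst z - fst z0)" "even (snd z - snd z0)"
  shows "6 * dist_par z0 z \<le> 5 * int n"
proof (rule dist_par_le)
  fix c assume c: "c \<in> charts"
  have "rmd (fst z) = rmd (fst z0)" "rmd (snd z) = rmd (snd z0)"
    using assms(2,3) by (simp_all add: rmd_def mod_eq_dvd_iff)
  then have "odds c z = odds c z0"
    using c by (auto simp: charts_def odds_def half_rmd_simps)
  then show "6 * (height c z - height c z0) \<le> 5 * int n"
    using free_walk_excess[OF c assms(1)] by simp
qed

section \<open>Canonical paths from the origin\<close>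

text \<open>A signed sum from 0 to x. Modulo 2 the sign disappears, so one recurrence,
  \<open>telescope_Suc\<close>, serves both sides of 0.\<close>

definition telescope :: "(int \<Rightarrow> edge \<Rightarrow> bit) \<Rightarrow> int \<Rightarrow> edge \<Rightarrow> bit" where
  "telescope f x = (\<Sum>j\<in>{min 0 x..<max 0 x}. f j)"

lemma telescope_0 [simp]: "telescope f 0 = 0"
  by (simp add: telescope_def)

lemma telescope_Suc: "telescope f (x + 1) = telescope f x + f x"
proof (cases "0 \<le> x")
  case True
  then have "{min 0 (x + 1)..<max 0 (x + 1)} = insert x {min 0 x..<max 0 x}"
    by auto
  with True show ?thesis
    by (simp add: telescope_def add.commute)
next
  case False
  then have "{min 0 x..<max 0 x} = insert x {min 0 (x + 1)..<max 0 (x + 1)}"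
    by auto
  with False show ?thesis
    by (simp add: telescope_def char2)
qed

text \<open>Every path from z to w is homologous to cpath z + cpath w, so that concatenation of paths
  becomes cancellation modulo 2.\<close>

definition cpath :: "nat \<Rightarrow> nat \<Rightarrow> vert \<Rightarrow> edge \<Rightarrow> bit" where
  "cpath k i z = telescope (\<lambda>j. seg k i (j, 0) 0) (fst z)
                + telescope (\<lambda>j. seg k i (fst z, j) 1) (snd z)"

lemma cpath_vertical: "cpath k i (x, y + 1) = cpath k i (x, y) + seg k i (x, y) 1"
  by (simp add: cpath_def telescope_Suc add.assoc)

text \<open>\<open>cpath\<close> follows the x-axis and then a vertical line. Vertical edges are
  therefore exact differences of canonical paths; a horizontal edge is one only up to the column of
  squares between it and the axis, and each step in y adds one square.\<close>

lemma nullhom_horizontal: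
  assumes "1 \<le> k" "i \<le> k"
  shows "nullhom k (seg k i (x, y) 0 + (cpath k i (x, y) + cpath k i (x + 1, y)))"
    (is "nullhom k (?H y)")
proof -
  have step: "?H (y + 1) = ?H y + square k i (x, y)" for y
    unfolding cpath_vertical square_def by (simp add: dir_def char2)
  show ?thesis
  proof (induction y rule: int_induct[of _ 0])
    case base
    show ?case
      unfolding cpath_def fst_conv snd_conv telescope_Suc by (simp add: char2)
  next
    case (step1 j)
    then show ?case
      unfolding step using nullhom_add nullhom_square[OF assms] by blast
  next
    case (step2 j)
    have "?H (j - 1) = ?H j + square k i (x, j - 1)"
      using step[of "j - 1"] by (simp add: char2)
    then show ?case
      using step2 nullhom_add nullhom_square[OF assms] by metis
  qed
qed

lemma nullhom_seg:
  assumes "1 \<le> k" "i \<le> k" "d \<in> {0, 1}"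
  shows "nullhom k (seg k i z d + (cpath k i z + cpath k i (z + dir d)))"
  using assms(3) nullhom_horizontal[OF assms(1,2), of "fst z" "snd z"]
    cpath_vertical[of k i "fst z" "snd z"]
  by (cases z) (auto simp: dir_def char2)

text \<open>The homology class of \<open>R\<close> is locally constant on Z^2, hence constant. This
  reduces comparisons of chains at distant points to a check on single edges.\<close>

lemma lattice_connected:
  assumes "\<And>z d. d \<in> {0, 1} \<Longrightarrow> nullhom k (R z + R (z + dir d))"
  shows "nullhom k (R z + R w)"
proof -
  have x: "nullhom k (R (a, b) + R (a + int n, b))" for a b n
  proof (induction n)
    case (Suc n)
    then show ?case
      using nullhom_trans[OF Suc assms[of 0 "(a + int n, b)"]] by (simp add: dir_def algebra_simps)
  qed simp
  have y: "nullhom k (R (a, b) + R (a, b + int n))" for a b n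
  proof (induction n)
    case (Suc n)
    then show ?case
      using nullhom_trans[OF Suc assms[of 1 "(a, b + int n)"]] by (simp add: dir_def algebra_simps)
  qed simp
  have "nullhom k (R (a, b) + R (a', b))" for a a' b
    using x[of a b "nat (a' - a)"] x[of a' b "nat (a - a')"] by (cases "a \<le> a'") (auto simp: add.commute)
  moreover have "nullhom k (R (a, b) + R (a, b'))" for a b b'
    using y[of a b "nat (b' - b)"] y[of a b' "nat (b - b')"] by (cases "b \<le> b'") (auto simp: add.commute)
  ultimately have "nullhom k (R (fst z, snd z) + R (fst w, snd w))"
    using nullhom_trans by blast
  then show ?thesis by simp
qed

text \<open>For a period t, \<open>cpath u + cpath (u + t)\<close> is a loop on the torus. Its class
  does not depend on u, because an edge and its translate are the same edge of the torus. Hence a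
  lifted path may be moved by any period.\<close>

lemma cpath_translate:
  assumes "1 \<le> k" "i \<le> k" "nrm i z = nrm i z'" "w - z = w' - z'"
  shows "nullhom k ((cpath k i z + cpath k i w) + (cpath k i z' + cpath k i w'))"
proof -
  define t where "t = z' - z"
  have t: "z' = z + t" "w' = w + t"
    using assms(4) by (auto simp: t_def algebra_simps)
  have nrm: "nrm i u = nrm i (u + t)" for u
    using assms(3) unfolding t(1) by (simp add: nrm_eq_iff)
  let ?R = "\<lambda>u. cpath k i u + cpath k i (u + t)"
  have "nullhom k (?R z + ?R w)"
  proof (rule lattice_connected)
    fix z and d :: nat assume d: "d \<in> {0, 1}"
    have "seg k i z d = seg k i (z + t) d"
      by (rule seg_cong[OF assms(2) nrm])
    then show "nullhom k (?R z + ?R (z + dir d))"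
      using nullhom_add[OF nullhom_seg[OF assms(1,2) d, of z] nullhom_seg[OF assms(1,2) d, of "z + t"]]
      by (simp add: char2)
  qed
  then show ?thesis
    unfolding t by (simp add: char2)
qed

lemma cpath_coarse:
  assumes "i < k"
  shows "nullhom k ((cpath k (Suc i) (z + z) + cpath k (Suc i) (w + w)) + (cpath k i z + cpath k i w))"
proof -
  let ?R = "\<lambda>u. cpath k (Suc i) (u + u) + cpath k i u"
  have k: "1 \<le> k" "Suc i \<le> k" "i \<le> k"
    using assms by auto
  have "nullhom k (?R z + ?R w)"
  proof (rule lattice_connected)
    fix z and d :: nat assume d: "d \<in> {0, 1}"
    show "nullhom k (?R z + ?R (z + dir d))"
      using nullhom_add[OF nullhom_seg[OF k(1,3) d, of z] nullhom_add[OF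
        nullhom_seg[OF k(1,2) d, of "z + z"] nullhom_seg[OF k(1,2) d, of "z + z + dir d"]]]
      unfolding seg_Suc[OF assms] by (simp add: char2)
  qed
  then show ?thesis by (simp add: char2)
qed

section \<open>Errors on a subtiling\<close>

definition emb :: "nat \<Rightarrow> nat \<Rightarrow> edge set \<Rightarrow> edge \<Rightarrow> bit" where
  "emb k i F = (\<Sum>f\<in>F. seg k i (fst f) (snd f))"

lemma emb_self: "F \<subseteq> edges k \<Longrightarrow> emb k k F = ind F"
proof -
  assume F: "F \<subseteq> edges k"
  have "emb k k F = (\<Sum>f\<in>F. ind {f})"
    unfolding emb_def seg_self
  proof (rule sum.cong)
    fix f assume "f \<in> F"
    then show "ind {(nrm k (fst f), snd f)} = ind {f}"
      using F by (cases f) (auto simp: edges_def)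
  qed simp
  then show ?thesis
    using ind_eq_sum[OF finite_subset[OF F finite_edges]] by simp
qed

text \<open>The class of c contains a chain of at most n edges of T_i. Keeping only an upper bound
  lets classes be added without tracking cancellation between representatives.\<close>

definition rep :: "nat \<Rightarrow> nat \<Rightarrow> nat \<Rightarrow> (edge \<Rightarrow> bit) \<Rightarrow> bool" where
  "rep k i n c \<longleftrightarrow> (\<exists>F\<subseteq>edges i. card F \<le> n \<and> nullhom k (c + emb k i F))"

lemma rep_0: "nullhom k c \<Longrightarrow> rep k i 0 c"
  unfolding rep_def by (intro exI[of _ "{}"]) (simp add: emb_def)

lemma rep_cong:
  assumes "rep k i n c" "nullhom k (c + c')"
  shows "rep k i n c'"
proof -
  have "nullhom k (c' + emb k i F)" if "nullhom k (c + emb k i F)" for F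
    using nullhom_add[OF assms(2) that] by (simp add: char2)
  then show ?thesis
    using assms(1) unfolding rep_def by blast
qed

lemma rep_add:
  assumes "rep k i n c" "rep k i m c'"
  shows "rep k i (n + m) (c + c')"
proof -
  obtain F G where F: "F \<subseteq> edges i" "card F \<le> n" "nullhom k (c + emb k i F)"
    and G: "G \<subseteq> edges i" "card G \<le> m" "nullhom k (c' + emb k i G)"
    using assms unfolding rep_def by blast
  then have fin: "finite F" "finite G"
    using finite_subset[OF _ finite_edges] by blast+
  have "card (symdiff F G) \<le> card (F \<union> G)"
    using fin by (intro card_mono) (auto simp: symdiff_def)
  also have "\<dots> \<le> n + m"
    using card_Un_le[of F G] F(2) G(2) by linarith
  finally have "card (symdiff F G) \<le> n + m" .
  moreover have "emb k i (symdiff F G) = emb k i F + emb k i G"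
    unfolding emb_def by (rule sum_symdiff[OF fin])
  then have "nullhom k ((c + c') + emb k i (symdiff F G))"
    using nullhom_add[OF F(3) G(3)] by (simp add: char2)
  ultimately show ?thesis
    unfolding rep_def using F(1) G(1) by (intro exI[of _ "symdiff F G"]) (auto simp: symdiff_def)
qed

lemma rep_seg:
  assumes "i \<le> k" "d \<in> {0, 1}"
  shows "rep k i 1 (seg k i z d)"
  unfolding rep_def using assms
  by (intro exI[of _ "{(nrm i z, d)}"]) (simp add: emb_def edges_def)

lemma rep_step:
  assumes "1 \<le> k" "i \<le> k" "d \<in> {0, 1}"
  shows "rep k i 1 (cpath k i z + cpath k i (z + dir d))"
  using rep_cong[OF rep_seg nullhom_seg] assms by blast

lemma rep_path:
  assumes k: "1 \<le> k" "i \<le> k"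
  shows "rep k i (nat (\<bar>fst w - fst z\<bar> + \<bar>snd w - snd z\<bar>)) (cpath k i z + cpath k i w)"
proof -
  have x: "rep k i n (cpath k i (a, b) + cpath k i (a + int n, b))" for a b n
  proof (induction n)
    case (Suc n)
    then show ?case
      using rep_add[OF Suc rep_step[OF k, of 0 "(a + int n, b)"]] by (simp add: dir_def algebra_simps)
  qed (simp add: rep_0)
  have y: "rep k i n (cpath k i (a, b) + cpath k i (a, b + int n))" for a b n
  proof (induction n)
    case (Suc n)
    then show ?case
      using rep_add[OF Suc rep_step[OF k, of 1 "(a, b + int n)"]] by (simp add: dir_def algebra_simps)
  qed (simp add: rep_0)
  have x': "rep k i (nat \<bar>a' - a\<bar>) (cpath k i (a, b) + cpath k i (a', b))" for a a' b
    using x[of "nat (a' - a)" a b] x[of "nat (a - a')" a' b]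
    by (cases "a \<le> a'") (auto simp: add.commute abs_if)
  have y': "rep k i (nat \<bar>b' - b\<bar>) (cpath k i (a, b) + cpath k i (a, b'))" for a b b'
    using y[of "nat (b' - b)" a b] y[of "nat (b - b')" a b']
    by (cases "b \<le> b'") (auto simp: add.commute abs_if)
  show ?thesis
    using rep_add[OF x'[of "fst w" "fst z" "snd z"] y'[of "snd w" "snd z" "fst w"]]
    by (simp add: nat_add_distrib add.assoc)
qed

section \<open>Syndromes\<close>

definition syn :: "nat \<Rightarrow> (edge \<Rightarrow> bit) \<Rightarrow> vert \<Rightarrow> bit" where
  "syn k c v = (\<Sum>f\<in>edges k. if v \<in> ends k f then c f else 0)"

lemma syn_0 [simp]: "syn k 0 = 0"
  unfolding syn_def zero_fun_def by (simp only: if_cancel sum.neutral_const)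

lemma syn_add: "syn k (a + b) = syn k a + syn k b"
proof
  fix v
  have "(\<Sum>f\<in>edges k. if v \<in> ends k f then (a + b) f else 0) =
    (\<Sum>f\<in>edges k. (if v \<in> ends k f then a f else 0) + (if v \<in> ends k f then b f else 0))"
    by (rule sum.cong) (auto simp: plus_fun_apply)
  then show "syn k (a + b) v = (syn k a + syn k b) v"
    unfolding syn_def plus_fun_apply by (simp only: sum.distrib)
qed

lemma syn_sum: "syn k (\<Sum>x\<in>A. f x) = (\<Sum>x\<in>A. syn k (f x))"
  by (induction A rule: infinite_finite_induct) (simp_all add: syn_add)

lemma ind_syndrome:
  assumes "A \<subseteq> edges k"
  shows "ind (syndrome k A) = syn k (ind A)"
proof
  fix v
  have "syn k (ind A) v = (\<Sum>f\<in>edges k. if f \<in> {f \<in> A. v \<in> ends k f} then 1 else 0)"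
    unfolding syn_def by (rule sum.cong) (auto simp: ind_def)
  also have "\<dots> = of_nat (card {f \<in> A. v \<in> ends k f})" 
  proof -
    have "edges k \<inter> {f \<in> A. v \<in> ends k f} = {f \<in> A. v \<in> ends k f}"
      using assms by blast
    then have "(\<Sum>f\<in>edges k. if f \<in> {f \<in> A. v \<in> ends k f} then 1 else 0) =
        (\<Sum>f\<in>{f \<in> A. v \<in> ends k f}. 1 :: bit)"
      by (simp only: sum.inter_restrict[OF finite_edges, symmetric])
    then show ?thesis
      by (simp only: card_eq_sum of_nat_sum of_nat_1)
  qed
  also have "\<dots> = ind (syndrome k A) v"
  proof (cases "v \<in> verts k")
    case False
    then have "{f \<in> A. v \<in> ends k f} = {}"
      using assms by (auto simp: ends_def edges_def shift_def)
    with False show ?thesis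
      by (simp only: ind_def) (simp add: syndrome_def)
  qed (simp add: ind_def syndrome_def of_nat_bit)
  finally show "ind (syndrome k A) v = syn k (ind A) v" ..
qed

lemma pt_self: "pt k k z = nrm k z"
  by (simp add: pt_def)

lemma syn_seg:
  assumes "1 \<le> k" "i \<le> k" "d \<in> {0, 1}"
  shows "syn k (seg k i z d) = ind {pt k i z} + ind {pt k i (z + dir d)}"
  using assms(2)
proof (induction i arbitrary: z rule: inc_induct)
  case base
  show ?case
  proof
    fix v
    have "(nrm k z, d) \<in> edges k"
      using assms(3) by (simp add: edges_def)
    then have "syn k (seg k k z d) v = (if v \<in> ends k (nrm k z, d) then 1 else 0)"
      unfolding syn_def seg_self
      by (subst sum.mono_neutral_right[of _ "{(nrm k z, d)}"]) (auto simp: ind_def)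
    moreover have "ends k (nrm k z, d) = {nrm k z, nrm k (z + dir d)}"
      using assms(3) by (auto simp: ends_def shift_nrm dir_def plus_prod_def)
    ultimately show "syn k (seg k k z d) v = (ind {pt k k z} + ind {pt k k (z + dir d)}) v"
      using nrm_dir_neq[OF assms(1), of z d]
      by (cases "v = nrm k z"; cases "v = nrm k (z + dir d)") (simp_all add: pt_self ind_def plus_fun_apply)
  qed
next
  case (step n)
  show ?case
    unfolding seg_Suc[OF step.hyps(2)] syn_add step.IH pt_Suc[OF step.hyps(2)] by (simp add: char2)
qed

lemma syn_square:
  assumes "1 \<le> k" "i \<le> k"
  shows "syn k (square k i z) = 0"
  unfolding square_def syn_add by (simp add: syn_seg[OF assms] char2)

lemma syn_nullhom:
  assumes "1 \<le> k" "nullhom k c"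
  shows "syn k c = 0"
proof -
  have "syn k (ind A) = 0" if "A \<in> face_span k" for A
    using that
  proof (induction A rule: face_span.induct)
    case (add A v)
    then show ?case
      using ind_face[OF assms(1), of v] syn_square[OF assms(1) order_refl, of v]
      by (simp add: ind_symdiff syn_add)
  qed simp
  from this[of "{f. c f = 1}"] show ?thesis
    using assms(2) by (simp add: nullhom_def ind_support)
qed

section \<open>Trails of links\<close>

definition xpartner :: "int \<Rightarrow> int" where
  "xpartner x = (if odd x then x + 1 else x - 1)"

definition ypartner :: "int \<Rightarrow> int" where
  "ypartner y = (if odd y then y - 1 else y + 1)"

text \<open>A link (z, t) is an edge of the tiling for t = 0 or t = 1, and for t = 2, 3, 4 a jump along
  the diagonal, the vertical side, the horizontal side of the D cell that contains z.\<close>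

definition oth :: "vert \<Rightarrow> nat \<Rightarrow> vert" where
  "oth z t = (if t < 2 then z + dir t
     else (if t = 3 then fst z else xpartner (fst z), if t = 4 then snd z else ypartner (snd z)))"

definition lends :: "nat \<Rightarrow> edge \<Rightarrow> vert set" where
  "lends i l = {fst l, nrm i (oth (fst l) (snd l))}"

definition lbd :: "nat \<Rightarrow> edge \<Rightarrow> vert \<Rightarrow> bit" where
  "lbd i l = ind {fst l} + ind {nrm i (oth (fst l) (snd l))}"

definition lchain :: "nat \<Rightarrow> nat \<Rightarrow> edge \<Rightarrow> edge \<Rightarrow> bit" where
  "lchain k i l = cpath k i (fst l) + cpath k i (oth (fst l) (snd l))"

definition retract :: "nat \<Rightarrow> nat \<Rightarrow> vert \<Rightarrow> edge \<Rightarrow> bit" where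
  "retract k i z = cpath k i z + cpath k i (par z + par z)"

lemma NN_dvd_even: "1 \<le> i \<Longrightarrow> NN i dvd a \<Longrightarrow> even a"
  by (metis NN_def dvd_power dvd_trans less_le_trans zero_less_one)

lemma nrm_eq_even:
  assumes "1 \<le> i" "nrm i z = nrm i w"
  shows "even (fst z - fst w)" "even (snd z - snd w)"
  using assms(2) NN_dvd_even[OF assms(1)] unfolding nrm_eq_iff by blast+

text \<open>The displacement along a link depends only on the parities of its starting point, and
  these are well defined on the torus as its period is even. So links of the torus can be
  lifted.\<close>

lemma oth_translate:
  assumes "1 \<le> i" "nrm i z = nrm i w"
  shows "oth z t - z = oth w t - w"
  using nrm_eq_even[OF assms] by (auto simp: oth_def xpartner_def ypartner_def prod_eq_iff)

lemma nrm_oth: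
  assumes "1 \<le> i" "nrm i z = nrm i w"
  shows "nrm i (oth z t) = nrm i (oth w t)"
proof -
  have "oth z t - oth w t = z - w"
    using oth_translate[OF assms, of t] by (simp add: algebra_simps)
  then have "fst (oth z t) - fst (oth w t) = fst z - fst w" "snd (oth z t) - snd (oth w t) = snd z - snd w"
    by (metis fst_diff, metis snd_diff)
  then show ?thesis
    using assms(2) by (simp add: nrm_eq_iff)
qed

lemma adj_oth: "t < 2 \<Longrightarrow> adj z (oth z t)"
  by (auto simp: adj_def oth_def dir_def)

lemma same_D_oth: "2 \<le> t \<Longrightarrow> same_D z (oth z t)"
  by (auto simp: same_D_def oth_def half_def xpartner_def ypartner_def elim!: evenE oddE)

lemma adj_commute: "adj z w \<longleftrightarrow> adj w z"
  by (auto simp: adj_def)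

lemma same_D_commute: "same_D z w \<longleftrightarrow> same_D w z"
  by (auto simp: same_D_def)

text \<open>Used links are recorded by their representatives on the torus, so that none is used
  twice, while the end point z stays in Z^2, where z - u records the winding. The flag is that of
  \<open>walk\<close>.\<close>

inductive trail :: "nat \<Rightarrow> edge set \<Rightarrow> vert \<Rightarrow> edge set \<Rightarrow> vert \<Rightarrow> bool \<Rightarrow> bool" for i X u where
  start: "trail i X u {} u True"
| forward: "trail i X u Y z j \<Longrightarrow> (nrm i z, t) \<in> X \<Longrightarrow> (nrm i z, t) \<notin> Y \<Longrightarrow>
    trail i X u (insert (nrm i z, t) Y) (oth z t) (2 \<le> t)"
| backward: "trail i X u Y (oth z t) j \<Longrightarrow> (nrm i z, t) \<in> X \<Longrightarrow> (nrm i z, t) \<notin> Y \<Longrightarrow>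
    trail i X u (insert (nrm i z, t) Y) z (2 \<le> t)"

lemma trail_subset: "trail i X u Y z j \<Longrightarrow> Y \<subseteq> X \<and> finite Y"
  by (induction rule: trail.induct) auto

lemma nrm_oth_nrm: "1 \<le> i \<Longrightarrow> nrm i (oth (nrm i z) t) = nrm i (oth z t)"
  by (rule nrm_oth) auto

lemma trail_boundary:
  assumes "1 \<le> i" "trail i X u Y z j"
  shows "(\<Sum>l\<in>Y. lbd i l) = ind {nrm i u} + ind {nrm i z}"
  using assms(2)
proof (induction rule: trail.induct)
  case (forward Y z j t)
  then show ?case
    using trail_subset[OF forward.hyps(1)] nrm_oth_nrm[OF assms(1)] by (simp add: lbd_def char2)
next
  case (backward Y z t j)
  then show ?case
    using trail_subset[OF backward.hyps(1)] nrm_oth_nrm[OF assms(1)] by (simp add: lbd_def char2)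
qed simp

lemma lchain_translate:
  assumes "1 \<le> i" "i \<le> k"
  shows "nullhom k (lchain k i (nrm i z, t) + (cpath k i z + cpath k i (oth z t)))"
  unfolding lchain_def fst_conv snd_conv
  using assms by (intro cpath_translate oth_translate[of i]) auto

lemma trail_chain:
  assumes "1 \<le> i" "i \<le> k" "trail i X u Y z j"
  shows "nullhom k ((\<Sum>l\<in>Y. lchain k i l) + (cpath k i u + cpath k i z))"
  using assms(3)
proof (induction rule: trail.induct)
  case (forward Y z j t)
  then show ?case
    using trail_subset[OF forward.hyps(1)] nullhom_add[OF forward.IH lchain_translate[OF assms(1,2), of z t]]
    by (simp add: char2)
next
  case (backward Y z t j)
  then show ?case
    using trail_subset[OF backward.hyps(1)] nullhom_add[OF backward.IH lchain_translate[OF assms(1,2), of z t]]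
    by (simp add: char2)
qed simp

lemma trail_free_walk:
  assumes "trail i X u Y z j"
  shows "free_walk u z (card Y)"
  using assms
proof (induction rule: trail.induct)
  case (forward Y z j t)
  have "adj z (oth z t) \<or> same_D z (oth z t)"
    using adj_oth same_D_oth by (cases "t < 2") auto
  then show ?case
    using forward trail_subset[OF forward.hyps(1)] by (auto intro: free_walk.step)
next
  case (backward Y z t j)
  have "adj (oth z t) z \<or> same_D (oth z t) z"
    using adj_oth same_D_oth adj_commute same_D_commute by (cases "t < 2") auto
  then show ?case
    using backward trail_subset[OF backward.hyps(1)] by (auto intro: free_walk.step)
qed (simp add: free_walk.start)

text \<open>Distinct jumps share no end point and none touches u, so a jump can neither open the
  trail nor follow a jump. The second conjunct carries this through the induction: when the flag is
  set, the jump at z is already used up, or nothing was used.\<close>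

lemma trail_walk:
  assumes "1 \<le> i" "trail i X u Y z j"
    and matching: "\<And>l l'. l \<in> X \<Longrightarrow> l' \<in> X \<Longrightarrow> 2 \<le> snd l \<Longrightarrow> 2 \<le> snd l' \<Longrightarrow>
      lends i l \<inter> lends i l' \<noteq> {} \<Longrightarrow> l = l'"
    and u: "\<And>l. l \<in> X \<Longrightarrow> 2 \<le> snd l \<Longrightarrow> nrm i u \<notin> lends i l"
  shows "walk u z (card Y) j \<and> (j \<longrightarrow> Y = {} \<and> z = u \<or> (\<exists>l\<in>Y. 2 \<le> snd l \<and> nrm i z \<in> lends i l))"
  using assms(2)
proof (induction rule: trail.induct)
  case start
  then show ?case by (simp add: walk.start)
next
  case (forward Y z j t)
  have lends: "lends i (nrm i z, t) = {nrm i z, nrm i (oth z t)}"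
    by (simp add: lends_def nrm_oth_nrm[OF assms(1)])
  have Y: "Y \<subseteq> X" "finite Y"
    using trail_subset[OF forward.hyps(1)] by auto
  show ?case
  proof (cases "t < 2")
    case True
    then show ?thesis
      using walk.edge[of u z "card Y" j "oth z t"] forward adj_oth[of t z] Y by simp
  next
    case False
    have "\<not> j"
    proof
      assume j
      then consider "z = u" | l where "l \<in> Y" "2 \<le> snd l" "nrm i z \<in> lends i l"
        using forward.IH by blast
      then show False
      proof cases
        case 1
        then show ?thesis using u[OF forward.hyps(2)] False lends by simp
      next
        case 2
        then have "l = (nrm i z, t)"
          using matching[of l "(nrm i z, t)"] Y forward.hyps(2) False lends by auto
        with 2 forward.hyps(3) show ?thesis by simp
      qed
    qed
    then show ?thesis
      using walk.jump[of u z "card Y" "oth z t"] forward same_D_oth[of t z] Y False lends by simp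
  qed
next
  case (backward Y z t j)
  have lends: "lends i (nrm i z, t) = {nrm i z, nrm i (oth z t)}"
    by (simp add: lends_def nrm_oth_nrm[OF assms(1)])
  have Y: "Y \<subseteq> X" "finite Y"
    using trail_subset[OF backward.hyps(1)] by auto
  show ?case
  proof (cases "t < 2")
    case True
    then show ?thesis
      using walk.edge[of u "oth z t" "card Y" j z] backward adj_oth[of t z] adj_commute Y by simp
  next
    case False
    have "\<not> j"
    proof
      assume j
      then consider "oth z t = u" | l where "l \<in> Y" "2 \<le> snd l" "nrm i (oth z t) \<in> lends i l"
        using backward.IH by blast
      then show False
      proof cases
        case 1
        then show ?thesis using u[OF backward.hyps(2)] False lends by auto
      next
        case 2
        then have "l = (nrm i z, t)"
          using matching[of l "(nrm i z, t)"] Y backward.hyps(2) False lends by auto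
        with 2 backward.hyps(3) show ?thesis by simp
      qed
    qed
    then show ?thesis
      using walk.jump[of u "oth z t" "card Y" z] backward same_D_oth[of t z] same_D_commute Y False lends
      by simp
  qed
qed

lemma maximal_trail:
  assumes i: "1 \<le> i" and X: "finite X" "X \<subseteq> verts i \<times> UNIV"
  obtains Y z j where "trail i X u Y z j" "\<And>l. l \<in> X - Y \<Longrightarrow> nrm i z \<notin> lends i l"
proof -
  define P where "P Y \<longleftrightarrow> (\<exists>z j. trail i X u Y z j)" for Y
  have "\<exists>Y. P Y \<and> (\<forall>Y'. P Y' \<longrightarrow> card Y' \<le> card Y)"
  proof (rule ex_has_greatest_nat)
    show "P {}"
      unfolding P_def using trail.start by blast
    show "\<forall>Y. P Y \<longrightarrow> card Y < Suc (card X)"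
      unfolding P_def less_Suc_eq_le by (auto dest!: trail_subset intro: card_mono[OF X(1)])
  qed
  then obtain Y z j where Y: "trail i X u Y z j" and max: "\<And>Y'. P Y' \<Longrightarrow> card Y' \<le> card Y"
    unfolding P_def by blast
  have no_ext: "\<not> P (insert l Y)" if "l \<in> X - Y" for l
    using max[of "insert l Y"] that trail_subset[OF Y] by auto
  have "nrm i z \<notin> lends i l" if l: "l \<in> X - Y" for l
  proof
    assume inc: "nrm i z \<in> lends i l"
    obtain w t where wt: "l = (w, t)" "w \<in> verts i"
      using l X(2) by (cases l) auto
    show False
    proof (cases "nrm i z = w")
      case True
      then have "trail i X u (insert l Y) (oth z t) (2 \<le> t)"
        using trail.forward[OF Y, of t] l wt by simp
      then have "P (insert l Y)"
        unfolding P_def by blast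
      with no_ext l show False by blast
    next
      case False
      then have z: "nrm i z = nrm i (oth w t)"
        using inc wt by (simp add: lends_def)
      \<comment> \<open>The lift of the link whose far end is z itself, not merely congruent to
        z.\<close>
      define z' where "z' = w + (z - oth w t)"
      have z': "nrm i z' = nrm i w"
        using z by (simp add: z'_def nrm_eq_iff)
      then have "oth z' t - z' = oth w t - w"
        by (rule oth_translate[OF i])
      then have "oth z' t = z"
        by (simp add: z'_def algebra_simps)
      then have "trail i X u (insert l Y) z' (2 \<le> t)"
        using trail.backward[of i X u Y z' t j] Y l wt z' by simp
      then have "P (insert l Y)"
        unfolding P_def by blast
      with no_ext l show False by blast
    qed
  qed
  with Y that show ?thesis by blast
qed

lemma retract_nrm:
  assumes "1 \<le> i" "i \<le> k"
  shows "nullhom k (retract k i z + retract k i (nrm i z))"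
  unfolding retract_def
proof (rule cpath_translate)
  have "even (fst z - fst (nrm i z))" "even (snd z - snd (nrm i z))"
    using nrm_eq_even[OF assms(1), of z "nrm i z"] by auto
  moreover have "half x + half x - x = half x' + half x' - x'"
    and "half (x + 1) + half (x + 1) - x = half (x' + 1) + half (x' + 1) - x'"
    if "even (x - x')" for x x'
    using that unfolding half_def by presburger+
  ultimately show "par z + par z - z = par (nrm i z) + par (nrm i z) - nrm i z"
    unfolding par_def prod_eq_iff fst_add snd_add fst_diff snd_diff fst_conv snd_conv by blast
qed (use assms in auto)

text \<open>Three homologies are added: the trail is a path from u to z, the retractions move its
  ends to corners of A cells, and between such corners the path can be drawn in T_i.\<close>

lemma trail_rep:
  assumes i: "Suc i \<le> k" and Y: "trail (Suc i) X u Y z j"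
  shows "rep k i (nat (dist_par u z))
    ((\<Sum>l\<in>Y. lchain k (Suc i) l) + (retract k (Suc i) u + retract k (Suc i) (nrm (Suc i) z)))"
proof (rule rep_cong)
  show "rep k i (nat (dist_par u z)) (cpath k i (par u) + cpath k i (par z))"
    unfolding dist_par_def using i by (intro rep_path) auto
  have "nullhom k ((\<Sum>l\<in>Y. lchain k (Suc i) l) + (cpath k (Suc i) u + cpath k (Suc i) z))"
    by (rule trail_chain[OF _ i Y]) simp
  moreover have "nullhom k (retract k (Suc i) z + retract k (Suc i) (nrm (Suc i) z))"
    by (rule retract_nrm[OF _ i]) simp
  moreover have "nullhom k ((cpath k (Suc i) (par u + par u) + cpath k (Suc i) (par z + par z))
      + (cpath k i (par u) + cpath k i (par z)))"
    using i by (intro cpath_coarse) simp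
  ultimately have "nullhom k (((\<Sum>l\<in>Y. lchain k (Suc i) l) + (cpath k (Suc i) u + cpath k (Suc i) z)) +
     ((retract k (Suc i) z + retract k (Suc i) (nrm (Suc i) z)) +
     ((cpath k (Suc i) (par u + par u) + cpath k (Suc i) (par z + par z))
      + (cpath k i (par u) + cpath k i (par z)))))"
    using nullhom_add by blast
  then show "nullhom k (cpath k i (par u) + cpath k i (par z) +
    ((\<Sum>l\<in>Y. lchain k (Suc i) l) + (retract k (Suc i) u + retract k (Suc i) (nrm (Suc i) z))))"
    unfolding retract_def by (simp add: char2)
qed

definition odd_verts :: "nat \<Rightarrow> edge set \<Rightarrow> vert set" where
  "odd_verts i X = {v. (\<Sum>l\<in>X. lbd i l) v = 1}"

lemma ind_odd_verts: "ind (odd_verts i X) = (\<Sum>l\<in>X. lbd i l)"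
  unfolding odd_verts_def by (rule ind_support)

lemma lbd_zero: "v \<notin> lends i l \<Longrightarrow> lbd i l v = 0"
  by (simp add: lbd_def lends_def ind_def plus_fun_apply)

lemma odd_verts_subset:
  assumes "X \<subseteq> verts i \<times> UNIV"
  shows "odd_verts i X \<subseteq> verts i"
proof
  fix v assume "v \<in> odd_verts i X"
  then have "(\<Sum>l\<in>X. lbd i l v) = 1"
    by (simp add: odd_verts_def sum_fun_apply)
  then obtain l where l: "l \<in> X" "lbd i l v \<noteq> 0"
    by (metis sum.neutral zero_neq_one)
  then have "v \<in> lends i l"
    using lbd_zero by blast
  then show "v \<in> verts i"
    using l assms by (auto simp: lends_def)
qed

text \<open>One maximal trail is removed at a time, started at an odd vertex as long as there is
  one. The inequality is twice the sum of the walk bounds: an open trail uses up two odd vertices,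
  which accounts for its extra 2. The hypotheses survive because the set of odd vertices only
  shrinks.\<close>

lemma trail_decomposition:
  assumes i: "Suc i \<le> k" and X: "finite X" "X \<subseteq> verts (Suc i) \<times> UNIV"
    and matching: "\<And>l l'. l \<in> X \<Longrightarrow> l' \<in> X \<Longrightarrow> 2 \<le> snd l \<Longrightarrow> 2 \<le> snd l' \<Longrightarrow>
      lends (Suc i) l \<inter> lends (Suc i) l' \<noteq> {} \<Longrightarrow> l = l'"
    and unmatched: "\<And>l. l \<in> X \<Longrightarrow> 2 \<le> snd l \<Longrightarrow> lends (Suc i) l \<inter> odd_verts (Suc i) X = {}"
    and cells: "\<And>z w. nrm (Suc i) z \<in> odd_verts (Suc i) X \<Longrightarrow> nrm (Suc i) w \<in> odd_verts (Suc i) X \<Longrightarrow>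
      same_D z w \<Longrightarrow> nrm (Suc i) z = nrm (Suc i) w"
  shows "\<exists>n. rep k i n ((\<Sum>l\<in>X. lchain k (Suc i) l) + (\<Sum>u\<in>odd_verts (Suc i) X. retract k (Suc i) u)) \<and>
    12 * n + card (odd_verts (Suc i) X) \<le> 10 * card X"
  using X matching unmatched cells
proof (induction "card X" arbitrary: X rule: less_induct)
  case less
  let ?i = "Suc i"
  let ?U = "odd_verts ?i X"
  have i1: "1 \<le> ?i" by simp
  have finU: "finite ?U"
    using odd_verts_subset[OF less.prems(2)] finite_subset[OF _ finite_verts] by blast
  show ?case
  proof (cases "X = {}")
    case True
    have "?U = {}"
      unfolding ind_inject[symmetric] ind_odd_verts using True by simp
    then show ?thesis
      using True by (intro exI[of _ 0]) (simp add: rep_0)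
  next
    case False
    obtain u where u: "u \<in> verts ?i" "?U = {} \<Longrightarrow> \<exists>l\<in>X. u \<in> lends ?i l" "?U \<noteq> {} \<Longrightarrow> u \<in> ?U"
    proof (cases "?U = {}")
      case True
      obtain l where "l \<in> X"
        using False by blast
      moreover from this have "fst l \<in> verts ?i"
        using less.prems(2) by auto
      moreover have "fst l \<in> lends ?i l"
        by (simp add: lends_def)
      ultimately show ?thesis
        using that True by blast
    next
      case False
      then show ?thesis
        using that odd_verts_subset[OF less.prems(2)] by blast
    qed
    obtain Y z j where Y: "trail ?i X u Y z j" and max: "\<And>l. l \<in> X - Y \<Longrightarrow> nrm ?i z \<notin> lends ?i l"
      using maximal_trail[OF i1 less.prems(1,2)] by blast
    let ?v = "nrm ?i z"
    let ?X = "X - Y"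
    have YX: "Y \<subseteq> X" "finite Y"
      using trail_subset[OF Y] by auto
    have bdY: "(\<Sum>l\<in>Y. lbd ?i l) = ind {u} + ind {?v}"
      using trail_boundary[OF i1 Y] u(1) by simp
    \<comment> \<open>By maximality no remaining link touches the end of the trail, so its parity in
      X is its parity in Y. A trail from an odd vertex thus ends at another odd vertex, and without
      odd vertices it closes up.\<close>
    have "(\<Sum>l\<in>?X. lbd ?i l) ?v = 0"
      unfolding sum_fun_apply using max lbd_zero by (intro sum.neutral) blast
    moreover note split = sum.subset_diff[OF YX(1) less.prems(1)]
    ultimately have indv: "ind ?U ?v = (ind {u} + ind {?v}) ?v"
      unfolding ind_odd_verts split[of "lbd ?i"] bdY by (simp add: plus_fun_apply)
    have vU: "?v \<in> ?U \<longleftrightarrow> u \<noteq> ?v"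
      using indv by (cases "u = ?v"; cases "?v \<in> ?U") (simp_all add: plus_fun_apply zero_fun_apply ind_def)
    have indU': "ind (odd_verts ?i ?X) = ind ?U + (ind {u} + ind {?v})"
      unfolding ind_odd_verts split[of "lbd ?i"] bdY by (simp add: char2)
    have "Y \<noteq> {}"
    proof
      assume "Y = {}"
      then have zu: "u = ?v"
        using bdY by (metis add_self_left add.right_neutral ind_inject singleton_inject sum.empty)
      then have "?U = {}"
        using vU u(3) by blast
      then show False
        using u(2) max \<open>Y = {}\<close> zu by auto
    qed
    then have card: "card ?X + card Y = card X" "card ?X < card X"
      using YX less.prems(1) card_mono[OF less.prems(1) YX(1)] card_gt_0_iff[of Y]
      by (simp_all add: card_Diff_subset)
    have key: "odd_verts ?i ?X \<subseteq> ?U \<and> card ?U \<le> card (odd_verts ?i ?X) + 2 * (if ?U = {} then 0 else 1) \<and>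
      (\<Sum>u\<in>?U. retract k ?i u) = (\<Sum>u\<in>odd_verts ?i ?X. retract k ?i u) + (retract k ?i u + retract k ?i ?v) \<and>
      6 * dist_par u z \<le> 5 * int (card Y) - (if ?U = {} then 0 else 1)"
    proof (cases "?U = {}")
      case True
      then have uv: "u = ?v"
        using vU by blast
      then have "odd_verts ?i ?X = {}"
        unfolding ind_inject[symmetric] indU' using True by simp
      moreover have "even (fst z - fst u)" "even (snd z - snd u)"
        using nrm_eq_even[OF i1, of z u] uv u(1) by auto
      then have "6 * dist_par u z \<le> 5 * int (card Y)"
        by (rule closed_walk_bound[OF trail_free_walk[OF Y]])
      ultimately show ?thesis
        using True uv by simp
    next
      case False
      then have uU: "u \<in> ?U" using u(3) by simp
      then have ne: "u \<noteq> ?v" and vU: "?v \<in> ?U"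
        using vU by metis+
      have U': "odd_verts ?i ?X = ?U - {u, ?v}"
      proof -
        have "ind {u, ?v} = ind {u} + ind {?v}"
          using ne by (intro ind_insert) simp
        moreover have "ind ?U = ind {u, ?v} + ind (?U - {u, ?v})"
          using uU vU by (subst ind_disjoint_Un[symmetric]) (auto simp: insert_absorb)
        ultimately have "ind (odd_verts ?i ?X) = ind (?U - {u, ?v})"
          using indU' by (simp add: char2)
        then show ?thesis by (simp add: ind_inject)
      qed
      have "nrm ?i u \<notin> lends ?i l" if "l \<in> X" "2 \<le> snd l" for l
        using less.prems(4)[OF that] uU u(1) by auto
      note tw = trail_walk[OF i1 Y less.prems(3) this]
      \<comment> \<open>Odd vertices carry no jump, so the trail also ends with an edge.\<close>
      moreover have "\<not> (\<exists>l\<in>Y. 2 \<le> snd l \<and> ?v \<in> lends ?i l)"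
        using less.prems(4) vU YX(1) by blast
      ultimately have "\<not> j"
        using \<open>Y \<noteq> {}\<close> by blast
      then have w: "walk u z (card Y) False"
        using tw by simp
      have "\<not> same_D u z"
        using less.prems(5)[of u z] uU vU ne nrm_id[OF u(1)] by metis
      then have "6 * dist_par u z \<le> 5 * int (card Y) - 1"
        by (rule open_walk_bound[OF w])
      moreover have "card (?U - {u, ?v}) = card ?U - 2" "2 \<le> card ?U"
        using uU vU ne finU card_mono[of ?U "{u, ?v}"] by (simp_all add: card_Diff_subset)
      moreover have "(\<Sum>u\<in>?U. retract k ?i u) =
          (\<Sum>u\<in>?U - {u, ?v}. retract k ?i u) + (retract k ?i u + retract k ?i ?v)"
        using sum.subset_diff[of "{u, ?v}" ?U "retract k ?i"] uU vU ne finU by simp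
      ultimately show ?thesis
        using False U' by auto
    qed
    have "\<exists>n. rep k i n ((\<Sum>l\<in>?X. lchain k ?i l) + (\<Sum>u\<in>odd_verts ?i ?X. retract k ?i u)) \<and>
      12 * n + card (odd_verts ?i ?X) \<le> 10 * card ?X"
    proof (rule less.hyps[OF card(2)])
      show "lends ?i l \<inter> odd_verts ?i ?X = {}" if "l \<in> ?X" "2 \<le> snd l" for l
        using less.prems(4)[of l] that key by blast
      show "nrm ?i z = nrm ?i w" if "nrm ?i z \<in> odd_verts ?i ?X" "nrm ?i w \<in> odd_verts ?i ?X" "same_D z w" for z w
        using less.prems(5)[of z w] that key by blast
    qed (use less.prems in auto)
    then obtain n where n: "rep k i n ((\<Sum>l\<in>?X. lchain k ?i l) + (\<Sum>u\<in>odd_verts ?i ?X. retract k ?i u))"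
      "12 * n + card (odd_verts ?i ?X) \<le> 10 * card ?X"
      by blast
    have "rep k i (n + nat (dist_par u z)) ((\<Sum>l\<in>X. lchain k ?i l) + (\<Sum>u\<in>?U. retract k ?i u))"
      using rep_add[OF n(1) trail_rep[OF i Y]] key split[of "lchain k ?i"] by (simp add: char2)
    moreover have "12 * (n + nat (dist_par u z)) + card ?U \<le> 10 * card X"
    proof -
      have "0 \<le> dist_par u z" by (simp add: dist_par_def)
      then have "12 * int (nat (dist_par u z)) + 2 * (if ?U = {} then 0 else 1) \<le> 10 * int (card Y)"
        using key by auto
      then have "12 * nat (dist_par u z) + 2 * (if ?U = {} then 0 else 1) \<le> 10 * card Y"
        by (simp split: if_splits)
      moreover have "card ?U \<le> card (odd_verts ?i ?X) + 2 * (if ?U = {} then 0 else 1)"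
        using key by blast
      moreover have "12 * (n + d) + c \<le> 10 * x"
        if "12 * d + b \<le> 10 * y" "c \<le> c' + b" "12 * n + c' \<le> 10 * x'" "x' + y = x" for b c c' d x x' y
        using that by presburger
      ultimately show ?thesis
        using n(2) card(1) by blast
    qed
    ultimately show ?thesis by blast
  qed
qed

section \<open>The reduction procedure in lattice coordinates\<close>

lemma nrm_add_nrm: "nrm k (fst (nrm k v) + a, snd (nrm k v) + b) = nrm k (fst v + a, snd v + b)"
  by (simp add: nrm_def mod_add_left_eq)

lemma corner_simps:
  "c\<alpha> (pt k i z) = pt k i z"
  "c\<beta> k (hh k i) (pt k i z) = pt k i (z + (1, 0))"
  "c\<gamma> k (hh k i) (pt k i z) = pt k i (z + (0, -1))"
  "c\<delta> k (hh k i) (pt k i z) = pt k i (z + (1, -1))"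
  using nrm_add_nrm[of k "(hh k i * fst z, hh k i * snd z)" "hh k i" 0]
    nrm_add_nrm[of k "(hh k i * fst z, hh k i * snd z)" 0 "- hh k i"]
    nrm_add_nrm[of k "(hh k i * fst z, hh k i * snd z)" "hh k i" "- hh k i"]
  by (simp_all add: c\<alpha>_def c\<beta>_def c\<gamma>_def c\<delta>_def pt_def algebra_simps)

lemma bij_blocks:
  assumes "Suc i \<le> k"
  shows "bij_betw (\<lambda>b. pt k (Suc i) (b + b)) (verts i) (blocks k (hh k (Suc i)))"
proof -
  have ik: "i < k" "i \<le> k" using assms by auto
  have h: "2 * hh k (Suc i) = hh k i" and N: "hh k i * NN i = NN k"
    using hh_Suc[OF ik(1)] hh_NN[OF ik(2)] by auto
  have hpos: "0 < hh k i" by simp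
  have pt: "pt k (Suc i) (b + b) = pt k i b" for b
    using pt_Suc[OF ik(1)] by simp
  have pt_verts: "pt k i b = (hh k i * fst b, hh k i * snd b)" if "b \<in> verts i" for b
  proof -
    have "0 \<le> hh k i * a \<and> hh k i * a < NN k" if "0 \<le> a" "a < NN i" for a
      using that hpos N by (metis mult_less_cancel_left_pos zero_le_mult_iff less_imp_le)
    then have "(hh k i * fst b, hh k i * snd b) \<in> verts k"
      using that by (simp add: verts_def)
    then show ?thesis
      unfolding pt_def by (rule nrm_id)
  qed
  show ?thesis
    unfolding pt bij_betw_def
  proof
    show "inj_on (pt k i) (verts i)"
      by (rule inj_onI) (simp add: pt_eq_iff[OF ik(2)])
    show "pt k i ` verts i = blocks k (hh k (Suc i))"
    proof
      show "pt k i ` verts i \<subseteq> blocks k (hh k (Suc i))"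
      proof (rule image_subsetI)
        fix b assume "b \<in> verts i"
        then show "pt k i b \<in> blocks k (hh k (Suc i))"
          using pt_in_verts[of k i b] pt_verts[of b] by (simp add: blocks_def h)
      qed
      show "blocks k (hh k (Suc i)) \<subseteq> pt k i ` verts i"
      proof
        fix v assume "v \<in> blocks k (hh k (Suc i))"
        then have v: "v \<in> verts k" "hh k i dvd fst v" "hh k i dvd snd v"
          by (auto simp: blocks_def h)
        then obtain a b where ab: "fst v = hh k i * a" "snd v = hh k i * b"
          by (auto elim!: dvdE)
        have "0 \<le> c \<and> c < NN i" if "0 \<le> hh k i * c" "hh k i * c < NN k" for c
          using that hpos unfolding N[symmetric] by (simp add: zero_le_mult_iff)
        then have "(a, b) \<in> verts i"
          using v(1) ab by (simp add: verts_def)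
        moreover from pt_verts[OF this] have "v = pt k i (a, b)"
          using ab by (simp add: prod_eq_iff)
        ultimately show "v \<in> pt k i ` verts i" by blast
      qed
    qed
  qed
qed

lemma blocks_range:
  assumes "Suc i \<le> k"
  shows "blocks k (hh k (Suc i)) = range (\<lambda>b. pt k (Suc i) (b + b))"
proof -
  have "pt k (Suc i) (b + b) = pt k (Suc i) (nrm i b + nrm i b)" for b
    using assms pt_Suc[of i k b] pt_Suc[of i k "nrm i b"] by simp
  then have "range (\<lambda>b. pt k (Suc i) (b + b)) = (\<lambda>b. pt k (Suc i) (b + b)) ` verts i"
    by (metis (no_types, lifting) UNIV_I image_cong image_eqI nrm_in_verts subsetI subset_antisym image_subset_iff)
  then show ?thesis
    using bij_blocks[OF assms] by (simp add: bij_betw_def)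
qed

lemma pt_oth:
  assumes "1 \<le> i" "i \<le> k" "pt k i z = pt k i w"
  shows "pt k i (oth z t) = pt k i (oth w t)"
  using assms nrm_oth[of i z w] by (simp add: pt_eq_iff)

lemma D_cell_cases:
  fixes z :: vert
  obtains b where "z = b + b + (1, -1)" | b where "z = b + b + (2, -1)"
    | b where "z = b + b + (1, -2)" | b where "z = b + b + (2, -2)"
proof -
  have "\<exists>a. x = a + a + 1 \<or> x = a + a + 2" for x :: int by presburger
  then obtain a where a: "fst z = a + a + 1 \<or> fst z = a + a + 2" by blast
  have "\<exists>b. y = b + b - 1 \<or> y = b + b - 2" for y :: int by presburger
  then obtain b where b: "snd z = b + b - 1 \<or> snd z = b + b - 2" by blast
  show ?thesis
    using a b that[of "(a, b)"] by (auto simp: prod_eq_iff)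
qed

lemma oth_simps:
  "oth (b + b + (1, -1)) 2 = b + b + (2, -2)" "oth (b + b + (2, -2)) 2 = b + b + (1, -1)"
  "oth (b + b + (2, -1)) 2 = b + b + (1, -2)" "oth (b + b + (1, -2)) 2 = b + b + (2, -1)"
  "oth (b + b + (0, -1)) 3 = b + b + (0, -2)" "oth (b + b + (0, -2)) 3 = b + b + (0, -1)"
  "oth (b + b + (1, -1)) 3 = b + b + (1, -2)" "oth (b + b + (1, -2)) 3 = b + b + (1, -1)"
  "oth (b + b + (1, 0)) 4 = b + b + (2, 0)" "oth (b + b + (2, 0)) 4 = b + b + (1, 0)"
  "oth (b + b + (1, -1)) 4 = b + b + (2, -1)" "oth (b + b + (2, -1)) 4 = b + b + (1, -1)"
  by (auto simp: oth_def xpartner_def ypartner_def prod_eq_iff)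

lemma add_offsets:
  "b + b + (1, -1) + (1, -1) = b + b + (2, -2)" "b + b + (1, -1) + (1, 0) = b + b + (2, -1)"
  "b + b + (1, -1) + (0, -1) = b + b + (1, -2)" "b + b + (0, -1) + (0, -1) = b + b + (0, -2)"
  "b + b + (0, -1) + (1, 0) = b + b + (1, -1)" "b + b + (0, -1) + (1, -1) = b + b + (1, -2)"
  "b + b + (1, 0) + (1, 0) = b + b + (2, 0)" "b + b + (1, 0) + (0, -1) = b + b + (1, -1)"
  "b + b + (1, 0) + (1, -1) = b + b + (2, -1)" for b :: vert
  by (auto simp: prod_eq_iff)

text \<open>Every vertex is a corner of a D cell of some block, which turns the removal over all
  blocks into a condition on z and its diagonal partner.\<close>

lemma pt_in_S1:
  assumes "Suc i \<le> k"
  shows "pt k (Suc i) z \<in> S1 k (hh k (Suc i)) S \<longleftrightarrow>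
    pt k (Suc i) z \<in> S \<and> pt k (Suc i) (oth z 2) \<notin> S"
proof -
  let ?p = "pt k (Suc i)"
  have if_iff: "q \<in> (if P then A else {}) \<longleftrightarrow> P \<and> q \<in> A" for q P and A :: "vert set"
    by simp
  have rem: "q \<in> rem1 k (hh k (Suc i)) S (?p (b + b)) \<longleftrightarrow>
      (\<exists>w\<in>{b + b + (1, -1), b + b + (2, -2), b + b + (2, -1), b + b + (1, -2)}.
        q = ?p w \<and> ?p w \<in> S \<and> ?p (oth w 2) \<in> S)" for q b
    unfolding rem1_def Let_def cellD_def corner_simps add_offsets Un_iff if_iff
    by (simp add: oth_simps) blast
  have "?p z \<in> (\<Union>x\<in>blocks k (hh k (Suc i)). rem1 k (hh k (Suc i)) S x) \<longleftrightarrow>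
      ?p z \<in> S \<and> ?p (oth z 2) \<in> S" (is "?L \<longleftrightarrow> ?R")
  proof
    assume ?L
    then obtain w where w: "?p z = ?p w" "?p w \<in> S" "?p (oth w 2) \<in> S"
      unfolding blocks_range[OF assms] UN_iff bex_simps rem by blast
    then show ?R
      using pt_oth[OF _ assms, of z w 2] by simp
  next
    assume R: ?R
    have "\<exists>b. z \<in> {b + b + (1, -1), b + b + (2, -2), b + b + (2, -1), b + b + (1, -2)}"
      by (cases z rule: D_cell_cases) blast+
    then show ?L
      unfolding blocks_range[OF assms] UN_iff bex_simps rem using R by blast
  qed
  then show ?thesis
    unfolding S1_def by blast
qed

text \<open>The vertical sides of a C cell are sides of the D cells of its own block and of the
  block to the left; the horizontal sides of a B cell are sides of the D cells of its own block and
  of the block above. So step 2 tests exactly the four sides of every D cell.\<close>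

lemma pt_in_S2:
  assumes "Suc i \<le> k"
  shows "pt k (Suc i) z \<in> S2 k (hh k (Suc i)) S \<longleftrightarrow>
    pt k (Suc i) z \<in> S \<and> pt k (Suc i) (oth z 3) \<notin> S \<and> pt k (Suc i) (oth z 4) \<notin> S"
proof -
  let ?p = "pt k (Suc i)"
  let ?V = "\<lambda>b. {b + b + (0, -1), b + b + (0, -2), b + b + (1, -1), b + b + (1, -2)}"
  let ?H = "\<lambda>b. {b + b + (1, 0), b + b + (2, 0), b + b + (1, -1), b + b + (2, -1)}"
  have if_iff: "q \<in> (if P then A else {}) \<longleftrightarrow> P \<and> q \<in> A" for q P and A :: "vert set"
    by simp
  have rem: "q \<in> rem2 k (hh k (Suc i)) S (?p (b + b)) \<longleftrightarrow>
      (\<exists>w\<in>?V b. q = ?p w \<and> ?p w \<in> S \<and> ?p (oth w 3) \<in> S) \<or>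
      (\<exists>w\<in>?H b. q = ?p w \<and> ?p w \<in> S \<and> ?p (oth w 4) \<in> S)" for q b
    unfolding rem2_def Let_def cellC_def cellB_def corner_simps add_offsets Un_iff if_iff
    by (simp add: oth_simps) blast
  have "?p z \<in> (\<Union>x\<in>blocks k (hh k (Suc i)). rem2 k (hh k (Suc i)) S x) \<longleftrightarrow>
      ?p z \<in> S \<and> (?p (oth z 3) \<in> S \<or> ?p (oth z 4) \<in> S)" (is "?L \<longleftrightarrow> ?R")
  proof
    assume ?L
    then obtain w where w: "?p z = ?p w" "?p w \<in> S" "?p (oth w 3) \<in> S \<or> ?p (oth w 4) \<in> S"
      unfolding blocks_range[OF assms] UN_iff bex_simps rem by blast
    then show ?R
      using pt_oth[OF _ assms, of z w 3] pt_oth[OF _ assms, of z w 4] by simp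
  next
    assume R: ?R
    \<comment> \<open>The right column and the bottom row of a D cell are handled by the
      neighbouring blocks, to the right and below.\<close>
    have shift: "b + b + (2, -1) = (b + (1, 0)) + (b + (1, 0)) + (0, -1)"
      "b + b + (2, -2) = (b + (1, 0)) + (b + (1, 0)) + (0, -2)"
      "b + b + (1, -2) = (b + (0, -1)) + (b + (0, -1)) + (1, 0)"
      "b + b + (2, -2) = (b + (0, -1)) + (b + (0, -1)) + (2, 0)" for b :: vert
      by (auto simp: prod_eq_iff)
    have "\<exists>b. z \<in> ?V b"
      by (cases z rule: D_cell_cases) (blast intro: shift)+
    moreover have "\<exists>b. z \<in> ?H b"
      by (cases z rule: D_cell_cases) (blast intro: shift)+
    ultimately obtain b b' where z: "z \<in> ?V b" "z \<in> ?H b'"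
      by (elim exE)
    have "\<exists>b. ?p z \<in> rem2 k (hh k (Suc i)) S (?p (b + b))"
      using conjunct2[OF R]
    proof
      assume "?p (oth z 3) \<in> S"
      then have "?p z \<in> rem2 k (hh k (Suc i)) S (?p (b + b))"
        unfolding rem using R by (intro disjI1 bexI[OF _ z(1)]) simp
      then show ?thesis ..
    next
      assume "?p (oth z 4) \<in> S"
      then have "?p z \<in> rem2 k (hh k (Suc i)) S (?p (b' + b'))"
        unfolding rem using R by (intro disjI2 bexI[OF _ z(2)]) simp
      then show ?thesis ..
    qed
    then show ?L
      unfolding blocks_range[OF assms] by blast
  qed
  then show ?thesis
    unfolding S2_def by blast
qed

section \<open>The output of the reduction procedure as a sum of jumps and retractions\<close>

text \<open>Turns sums over blocks into sums over vertices: a corner at a fixed offset visits each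
  vertex of one parity class once.\<close>

lemma bij_parity_class:
  "bij_betw (\<lambda>b. nrm (Suc i) (b + b + c)) (verts i)
     {z \<in> verts (Suc i). even (fst z - fst c) \<and> even (snd z - snd c)}"
  unfolding bij_betw_def
proof
  have N: "NN (Suc i) = 2 * NN i" by (simp add: NN_def)
  have dvd: "NN (Suc i) dvd a + a - (b + b) \<longleftrightarrow> NN i dvd a - b" for a b
    unfolding N using dvd_mult_cancel_left[of 2 "NN i" "a - b"] by (simp add: algebra_simps)
  show "inj_on (\<lambda>b. nrm (Suc i) (b + b + c)) (verts i)"
  proof (rule inj_onI)
    fix a b assume ab: "a \<in> verts i" "b \<in> verts i" "nrm (Suc i) (a + a + c) = nrm (Suc i) (b + b + c)"
    then have "nrm i a = nrm i b"
      unfolding nrm_eq_iff fst_add snd_add add_diff_cancel_right dvd by simp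
    with ab show "a = b" by simp
  qed
  have par: "even (fst (nrm (Suc i) z) - fst z)" "even (snd (nrm (Suc i) z) - snd z)" for z
    using nrm_eq_even[of "Suc i" "nrm (Suc i) z" z] by auto
  show "(\<lambda>b. nrm (Suc i) (b + b + c)) ` verts i =
      {z \<in> verts (Suc i). even (fst z - fst c) \<and> even (snd z - snd c)}" (is "?L = ?R")
  proof
    have "even (fst (nrm (Suc i) (b + b + c)) - fst c)" "even (snd (nrm (Suc i) (b + b + c)) - snd c)" for b
      using par[of "b + b + c"] by auto
    then show "?L \<subseteq> ?R" by auto
    show "?R \<subseteq> ?L"
    proof
      fix z assume "z \<in> ?R"
      then have z: "z \<in> verts (Suc i)" and ev: "even (fst z - fst c)" "even (snd z - snd c)"
        by blast+
      obtain x where x: "fst z - fst c = 2 * x"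
        using ev(1) by (rule evenE)
      obtain y where y: "snd z - snd c = 2 * y"
        using ev(2) by (rule evenE)
      have zc: "z = (x, y) + (x, y) + c"
        using x y by (simp add: prod_eq_iff)
      let ?b = "nrm i (x, y)"
      have "NN i dvd fst ?b - x" "NN i dvd snd ?b - y"
        using nrm_eq_iff[of i ?b "(x, y)"] by auto
      then have "nrm (Suc i) (?b + ?b + c) = nrm (Suc i) z"
        unfolding nrm_eq_iff zc fst_add snd_add add_diff_cancel_right dvd by simp
      then have "z = nrm (Suc i) (?b + ?b + c)"
        using z by simp
      then show "z \<in> ?L"
        by (rule image_eqI) simp
    qed
  qed
qed

lemma sum_parity_class:
  assumes "\<And>z. g (nrm (Suc i) z) = g z"
  shows "(\<Sum>b\<in>verts i. g (b + b + c)) =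
    (\<Sum>z\<in>{z \<in> verts (Suc i). even (fst z - fst c) \<and> even (snd z - snd c)}. g z)"
  using sum.reindex_bij_betw[OF bij_parity_class[of i c], of g] by (simp add: assms)

text \<open>The flips of steps 1 and 2, written from the upper end of the jump, or from its left end
  for t = 4. Both diagonals are routed through the bottom side of the D cell.\<close>

definition jump_chain :: "nat \<Rightarrow> nat \<Rightarrow> nat \<Rightarrow> vert \<Rightarrow> edge \<Rightarrow> bit" where
  "jump_chain k i t z =
     (if t = 2 then if odd (fst z) then seg k i (z + (0, -1)) 1 + seg k i (z + (0, -1)) 0
                    else seg k i (z + (-1, -1)) 0 + seg k i (z + (0, -1)) 1
      else if t = 3 then seg k i (z + (0, -1)) 1
      else seg k i z 0)"

definition retract_chain :: "nat \<Rightarrow> nat \<Rightarrow> vert \<Rightarrow> edge \<Rightarrow> bit" where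
  "retract_chain k i z =
     (if odd (fst z) then if odd (snd z) then seg k i (z + (-1, 0)) 1 + seg k i (z + (-1, 0)) 0
                          else seg k i (z + (-1, 0)) 0
      else if odd (snd z) then seg k i z 1 else 0)"

text \<open>Every jump is listed once, at its end point with this property.\<close>

definition jump_source :: "nat \<Rightarrow> vert \<Rightarrow> bool" where
  "jump_source t z \<longleftrightarrow> (if t = 4 then odd (fst z) else odd (snd z))"

lemma nullhom_two_segs:
  assumes "1 \<le> k" "i \<le> k" "d \<in> {0, 1}" "d' \<in> {0, 1}" "{a, c} = {z, z + dir d}" "{b, c} = {w, w + dir d'}"
  shows "nullhom k (seg k i z d + seg k i w d' + (cpath k i a + cpath k i b))"
proof -
  have "cpath k i a + cpath k i c = cpath k i z + cpath k i (z + dir d)"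
    "cpath k i b + cpath k i c = cpath k i w + cpath k i (w + dir d')"
    using assms(5,6) by (auto simp: doubleton_eq_iff add.commute)
  then have "nullhom k (seg k i z d + (cpath k i a + cpath k i c))" "nullhom k (seg k i w d' + (cpath k i b + cpath k i c))"
    using nullhom_seg[OF assms(1,2)] assms(3,4) by simp_all
  from nullhom_add[OF this] show ?thesis
    by (simp add: char2)
qed

lemma nullhom_one_seg:
  assumes "1 \<le> k" "i \<le> k" "d \<in> {0, 1}" "{a, b} = {z, z + dir d}"
  shows "nullhom k (seg k i z d + (cpath k i a + cpath k i b))"
proof -
  have "cpath k i a + cpath k i b = cpath k i z + cpath k i (z + dir d)"
    using assms(4) by (auto simp: doubleton_eq_iff add.commute)
  then show ?thesis
    using nullhom_seg[OF assms(1-3)] by simp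
qed

lemma nullhom_jump_chain:
  assumes "1 \<le> k" "i \<le> k" "t \<in> {2, 3, 4}" "jump_source t z"
  shows "nullhom k (jump_chain k i t z + lchain k i (z, t))"
proof -
  obtain x y where z: "z = (x, y)" by fastforce
  consider "t = 2" "odd x" "odd y" | "t = 2" "even x" "odd y" | "t = 3" "odd y" | "t = 4" "odd x"
    using assms(3,4) z by (cases "odd x") (auto simp: jump_source_def)
  then show ?thesis
  proof cases
    case 1
    show ?thesis
      unfolding jump_chain_def lchain_def using 1 z
      by (simp add: oth_def xpartner_def ypartner_def)
        (rule nullhom_two_segs[OF assms(1,2), where c = "(x, y - 1)"]; auto simp: dir_def)
  next
    case 2
    have "nullhom k (seg k i (x, y - 1) 1 + seg k i (x - 1, y - 1) 0 +
        (cpath k i (x, y) + cpath k i (x - 1, y - 1)))"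
      by (rule nullhom_two_segs[OF assms(1,2), where c = "(x, y - 1)"]; auto simp: dir_def)
    then show ?thesis
      unfolding jump_chain_def lchain_def using 2 z
      by (simp add: oth_def xpartner_def ypartner_def add.commute[of "seg k i (x, y - 1) (Suc 0)"])
  next
    case 3
    show ?thesis
      unfolding jump_chain_def lchain_def using 3 z
      by (simp add: oth_def xpartner_def ypartner_def)
        (rule nullhom_one_seg[OF assms(1,2)]; auto simp: dir_def)
  next
    case 4
    show ?thesis
      unfolding jump_chain_def lchain_def using 4 z
      by (simp add: oth_def xpartner_def ypartner_def)
        (rule nullhom_one_seg[OF assms(1,2)]; auto simp: dir_def)
  qed
qed

lemma nullhom_retract_chain:
  assumes "1 \<le> k" "i \<le> k"
  shows "nullhom k (retract_chain k i z + retract k i z)"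
proof -
  obtain x y where z: "z = (x, y)" by fastforce
  have par: "half x + half x = (if odd x then x - 1 else x)"
    "half (y + 1) + half (y + 1) = (if odd y then y + 1 else y)"
    unfolding half_def by presburger+
  have par: "par z + par z = (if odd x then x - 1 else x, if odd y then y + 1 else y)"
    using par by (simp add: par_def z)
  consider "odd x" "odd y" | "odd x" "even y" | "even x" "odd y" | "even x" "even y" by blast
  then show ?thesis
  proof cases
    case 1
    have "nullhom k (seg k i (x - 1, y) 0 + seg k i (x - 1, y) 1 +
        (cpath k i (x, y) + cpath k i (x - 1, y + 1)))"
      by (rule nullhom_two_segs[OF assms, where c = "(x - 1, y)"]; auto simp: dir_def)
    then show ?thesis
      unfolding retract_chain_def retract_def par using 1 z
      by (simp add: add.commute[of "seg k i (x - 1, y) 0"])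
  next
    case 2
    show ?thesis
      unfolding retract_chain_def retract_def par using 2 z
      by simp (rule nullhom_one_seg[OF assms]; auto simp: dir_def)
  next
    case 3
    show ?thesis
      unfolding retract_chain_def retract_def par using 3 z
      by simp (rule nullhom_one_seg[OF assms]; auto simp: dir_def)
  next
    case 4
    show ?thesis
      unfolding retract_chain_def retract_def par using 4 z by simp
  qed
qed

text \<open>A flip together with its test, as a function on Z^2 that is invariant under periods; in
  this form sums over blocks can be reindexed.\<close>

definition gate :: "nat \<Rightarrow> nat \<Rightarrow> nat \<Rightarrow> vert set \<Rightarrow> vert \<Rightarrow> edge \<Rightarrow> bit" where
  "gate k i t T z = (if pt k i z \<in> T \<and> pt k i (oth z t) \<in> T then jump_chain k i t z else 0)"

definition rgate :: "nat \<Rightarrow> nat \<Rightarrow> vert set \<Rightarrow> vert \<Rightarrow> edge \<Rightarrow> bit" where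
  "rgate k i T z = (if pt k i z \<in> T then retract_chain k i z else 0)"

lemma nrm_add: "nrm i (nrm i z + c) = nrm i (z + c)"
  by (simp add: nrm_def mod_add_left_eq)

lemma even_nrm:
  assumes "1 \<le> i"
  shows "even (fst (nrm i z)) \<longleftrightarrow> even (fst z)" "even (snd (nrm i z)) \<longleftrightarrow> even (snd z)"
  using nrm_eq_even[OF assms, of "nrm i z" z] by auto

lemma gate_nrm:
  assumes "1 \<le> i" "i \<le> k"
  shows "gate k i t T (nrm i z) = gate k i t T z"
proof -
  have "seg k i (nrm i z + c) d = seg k i (z + c) d" for c d
    by (rule seg_cong[OF assms(2) nrm_add])
  moreover have "pt k i (oth (nrm i z) t) = pt k i (oth z t)"
    by (rule pt_oth[OF assms]) (use assms in simp)
  ultimately show ?thesis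
    using assms by (simp add: gate_def jump_chain_def even_nrm)
qed

lemma rgate_nrm:
  assumes "1 \<le> i" "i \<le> k"
  shows "rgate k i T (nrm i z) = rgate k i T z"
proof -
  have "seg k i (nrm i z + c) d = seg k i (z + c) d" for c d
    by (rule seg_cong[OF assms(2) nrm_add])
  then show ?thesis
    using assms by (simp add: rgate_def retract_chain_def even_nrm)
qed

lemma tpath_subset: "v \<in> verts k \<Longrightarrow> d \<in> {0, 1} \<Longrightarrow> tpath k h (v, d) \<subseteq> edges k"
  by (auto simp: tpath_def edges_def shift_def)

lemma ind_reduce:
  assumes "Suc i \<le> k"
  shows "ind (reduce k (Suc i) S) = (\<Sum>b\<in>verts i. \<Sum>g\<leftarrow>flips k (hh k (Suc i)) S (pt k (Suc i) (b + b)).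
      ind (tpath k (hh k (Suc i)) g))"
proof -
  let ?h = "hh k (Suc i)"
  have tp: "tpath k ?h g \<subseteq> edges k" if "b \<in> blocks k ?h" "g \<in> set (flips k ?h S b)" for b g
  proof -
    have "fst g \<in> verts k \<and> snd g \<in> {0, 1}"
      using that
      by (auto simp: blocks_def flips_def flips1_def flips2_def flips3_def Let_def cellA_def cellB_def cellC_def
        cellD_def c\<alpha>_def c\<beta>_def c\<gamma>_def c\<delta>_def Et_def Eb_def El_def Er_def split: if_splits)
    then show ?thesis
      using tpath_subset[of "fst g" k "snd g"] by simp
  qed
  have len: "of_nat (length (filter (\<lambda>g. f \<in> tpath k ?h g) gs)) = (\<Sum>g\<leftarrow>gs. ind (tpath k ?h g) f)" for f gs
    by (induction gs) (simp_all add: ind_def)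
  have "ind (reduce k (Suc i) S) = (\<Sum>b\<in>blocks k ?h. \<Sum>g\<leftarrow>flips k ?h S b. ind (tpath k ?h g))"
  proof
    fix f
    have "(\<Sum>b\<in>blocks k ?h. \<Sum>g\<leftarrow>flips k ?h S b. ind (tpath k ?h g)) f =
        of_nat (\<Sum>b\<in>blocks k ?h. length (filter (\<lambda>g. f \<in> tpath k ?h g) (flips k ?h S b)))"
      unfolding of_nat_sum len sum_fun_apply sum_list_fun_apply ..
    also have "\<dots> = ind (reduce k (Suc i) S) f"
    proof (cases "f \<in> edges k")
      case True
      then show ?thesis
        unfolding of_nat_bit ind_def reduce_def Let_def by simp
    next
      case False
      have "length (filter (\<lambda>g. f \<in> tpath k ?h g) (flips k ?h S b)) = 0" if "b \<in> blocks k ?h" for b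
        using tp[OF that] False by (auto simp: filter_empty_conv)
      then have "(\<Sum>b\<in>blocks k ?h. length (filter (\<lambda>g. f \<in> tpath k ?h g) (flips k ?h S b))) = 0"
        by (intro sum.neutral) blast
      then show ?thesis
        using False by (simp only:) (simp add: ind_def reduce_def Let_def)
    qed
    finally show "ind (reduce k (Suc i) S) f = (\<Sum>b\<in>blocks k ?h. \<Sum>g\<leftarrow>flips k ?h S b. ind (tpath k ?h g)) f" ..
  qed
  also have "\<dots> = (\<Sum>b\<in>verts i. \<Sum>g\<leftarrow>flips k ?h S (pt k (Suc i) (b + b)). ind (tpath k ?h g))"
    by (rule sum.reindex_bij_betw[OF bij_blocks[OF assms], symmetric])
  finally show ?thesis .
qed

lemma sum_list_if: "(\<Sum>g\<leftarrow>(if P then xs else []). f g) = (if P then (\<Sum>g\<leftarrow>xs. f g) else 0)"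
  by simp

text \<open>The terms are the two diagonals of the D cell, the two vertical sides of the C cell, the
  two horizontal sides of the B cell and the four corners of the A cell.\<close>

lemma flips_gates:
  fixes b :: vert
  defines "c \<equiv> b + b"
  shows "(\<Sum>g\<leftarrow>flips k (hh k i) S (pt k i c). ind (tpath k (hh k i) g)) =
    (gate k i 2 S (c + (1, -1)) + gate k i 2 S (c + (2, -1))) +
    (gate k i 3 (S1 k (hh k i) S) (c + (0, -1)) + gate k i 3 (S1 k (hh k i) S) (c + (1, -1))) +
    (gate k i 4 (S1 k (hh k i) S) (c + (1, 0)) + gate k i 4 (S1 k (hh k i) S) (c + (1, -1))) +
    (rgate k i (S2 k (hh k i) (S1 k (hh k i) S)) (c + (0, 0)) +
     rgate k i (S2 k (hh k i) (S1 k (hh k i) S)) (c + (1, 0)) +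
     rgate k i (S2 k (hh k i) (S1 k (hh k i) S)) (c + (0, -1)) +
     rgate k i (S2 k (hh k i) (S1 k (hh k i) S)) (c + (1, -1)))"
proof -
  have par: "even (fst c)" "even (snd c)" by (simp_all add: c_def)
  have off: "c + (1, -1) + (0, -1) = c + (1, -2)" "c + (2, -1) + (-1, -1) = c + (1, -2)"
    "c + (2, -1) + (0, -1) = c + (2, -2)" "c + (0, -1) + (0, -1) = c + (0, -2)"
    "c + (1, 0) + (-1, 0) = c" "c + (1, -1) + (-1, 0) = c + (0, -1)" "c + (0, 0) = c"
    by (simp_all add: prod_eq_iff)
  have 1: "(\<Sum>g\<leftarrow>flips1 k (hh k i) T (pt k i c). ind (tpath k (hh k i) g)) =
      gate k i 2 T (c + (1, -1)) + gate k i 2 T (c + (2, -1))" for T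
    unfolding flips1_def Let_def cellD_def El_def Eb_def Er_def corner_simps map_append sum_list_append
      sum_list_if gate_def jump_chain_def seg_def c_def add_offsets oth_simps
    using par by (simp add: c_def off[unfolded c_def])
  have 2: "(\<Sum>g\<leftarrow>flips2 k (hh k i) T (pt k i c). ind (tpath k (hh k i) g)) =
     (gate k i 3 T (c + (0, -1)) + gate k i 3 T (c + (1, -1))) +
     (gate k i 4 T (c + (1, 0)) + gate k i 4 T (c + (1, -1)))" for T
    unfolding flips2_def Let_def cellC_def cellB_def El_def Eb_def Er_def Et_def corner_simps map_append
      sum_list_append sum_list_if gate_def jump_chain_def seg_def c_def add_offsets oth_simps
    using par by (simp add: c_def off[unfolded c_def] add.assoc)
  have 3: "(\<Sum>g\<leftarrow>flips3 k (hh k i) T (pt k i c). ind (tpath k (hh k i) g)) =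
     rgate k i T (c + (0, 0)) + rgate k i T (c + (1, 0)) + rgate k i T (c + (0, -1)) + rgate k i T (c + (1, -1))" for T
    unfolding flips3_def Let_def cellA_def El_def Eb_def Et_def corner_simps map_append
      sum_list_append sum_list_if rgate_def retract_chain_def seg_def
    using par by (simp add: off)
  show ?thesis
    unfolding flips_def map_append sum_list_append 1 2 3 by (simp only: add.assoc)
qed

definition jumps :: "nat \<Rightarrow> nat \<Rightarrow> nat \<Rightarrow> vert set \<Rightarrow> edge set" where
  "jumps k i t T = {z \<in> verts i. jump_source t z \<and> pt k i z \<in> T \<and> pt k i (oth z t) \<in> T} \<times> {t}"

definition jump_ends :: "nat \<Rightarrow> nat \<Rightarrow> nat \<Rightarrow> vert set \<Rightarrow> vert set" where
  "jump_ends k i t T = {z \<in> verts i. pt k i z \<in> T \<and> pt k i (oth z t) \<in> T}"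

lemma finite_jumps [simp]: "finite (jumps k i t T)"
  by (simp add: jumps_def)

lemma sum_jumps: "(\<Sum>l\<in>jumps k i t T. f l) =
    (\<Sum>z\<in>{z \<in> verts i. jump_source t z \<and> pt k i z \<in> T \<and> pt k i (oth z t) \<in> T}. f (z, t))"
  unfolding jumps_def by (simp add: sum.cartesian_product')

text \<open>The last two hypotheses split the sources of jumps of type t into the disjoint parity
  classes of the offsets c and c', so that every jump is counted once.\<close>

lemma nullhom_gates:
  assumes "Suc i \<le> k" "t \<in> {2, 3, 4}"
    and "{z \<in> verts (Suc i). jump_source t z} =
      {z \<in> verts (Suc i). even (fst z - fst c) \<and> even (snd z - snd c)} \<union>
      {z \<in> verts (Suc i). even (fst z - fst c') \<and> even (snd z - snd c')}"
    and "odd (fst c - fst c') \<or> odd (snd c - snd c')"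
  shows "nullhom k ((\<Sum>b\<in>verts i. gate k (Suc i) t T (b + b + c) + gate k (Suc i) t T (b + b + c')) +
    (\<Sum>l\<in>jumps k (Suc i) t T. lchain k (Suc i) l))"
proof -
  let ?i = "Suc i"
  let ?C = "\<lambda>c :: vert. {z \<in> verts ?i. even (fst z - fst c) \<and> even (snd z - snd c)}"
  have "(\<Sum>b\<in>verts i. gate k ?i t T (b + b + c) + gate k ?i t T (b + b + c')) =
      (\<Sum>z\<in>?C c. gate k ?i t T z) + (\<Sum>z\<in>?C c'. gate k ?i t T z)"
    unfolding sum.distrib using assms(1) by (simp only: sum_parity_class gate_nrm le_add1 One_nat_def Suc_le_mono le0)
  also have "\<dots> = (\<Sum>z\<in>?C c \<union> ?C c'. gate k ?i t T z)"
  proof (rule sum.union_disjoint[symmetric])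
    have "\<not> (even (x - a) \<and> even (x - b))" if "odd (a - b)" for x a b :: int
      using that by presburger
    then show "?C c \<inter> ?C c' = {}"
      using assms(4) by blast
  qed simp_all
  also have "\<dots> = (\<Sum>z\<in>{z \<in> verts ?i. jump_source t z}. gate k ?i t T z)"
    using assms(3) by simp
  also have "\<dots> = (\<Sum>z\<in>{z \<in> verts ?i. jump_source t z \<and> pt k ?i z \<in> T \<and> pt k ?i (oth z t) \<in> T}.
      jump_chain k ?i t z)"
    by (rule sum.mono_neutral_cong_right) (auto simp: gate_def)
  finally have eq: "(\<Sum>b\<in>verts i. gate k ?i t T (b + b + c) + gate k ?i t T (b + b + c')) =
      (\<Sum>z\<in>{z \<in> verts ?i. jump_source t z \<and> pt k ?i z \<in> T \<and> pt k ?i (oth z t) \<in> T}. jump_chain k ?i t z)" .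
  show ?thesis
    unfolding eq sum_jumps using assms(1,2) by (intro nullhom_sum_cong nullhom_jump_chain) auto
qed

text \<open>From here on the procedure enters only through its homology class: jumps along the
  matched pairs and retractions of the leftover vertices. The routes taken by the flips no longer
  matter.\<close>

lemma nullhom_reduce:
  assumes "Suc i \<le> k"
  defines "h \<equiv> hh k (Suc i)"
  shows "nullhom k (ind (reduce k (Suc i) S) +
    ((\<Sum>l\<in>jumps k (Suc i) 2 S. lchain k (Suc i) l) + (\<Sum>l\<in>jumps k (Suc i) 3 (S1 k h S). lchain k (Suc i) l) +
     (\<Sum>l\<in>jumps k (Suc i) 4 (S1 k h S). lchain k (Suc i) l) +
     (\<Sum>z\<in>{z \<in> verts (Suc i). pt k (Suc i) z \<in> S2 k h (S1 k h S)}. retract k (Suc i) z)))"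
proof -
  let ?i = "Suc i"
  let ?C = "\<lambda>c :: vert. {z \<in> verts ?i. even (fst z - fst c) \<and> even (snd z - snd c)}"
  let ?r = "rgate k ?i (S2 k h (S1 k h S))"
  have r_nrm: "?r (nrm ?i z) = ?r z" for z
    using assms(1) by (intro rgate_nrm) auto
  have "(\<Sum>b\<in>verts i. ?r (b + b + (0, 0)) + ?r (b + b + (1, 0)) + ?r (b + b + (0, -1)) + ?r (b + b + (1, -1))) =
    (\<Sum>z\<in>?C (0, 0). ?r z) + (\<Sum>z\<in>?C (1, 0). ?r z) + (\<Sum>z\<in>?C (0, -1). ?r z) + (\<Sum>z\<in>?C (1, -1). ?r z)"
    unfolding sum.distrib sum_parity_class[of ?r, OF r_nrm] ..
  also have "\<dots> = (\<Sum>z\<in>?C (0, 0) \<union> ?C (1, 0) \<union> ?C (0, -1) \<union> ?C (1, -1). ?r z)"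
    by (subst sum.union_disjoint, simp_all, fastforce)+
  also have "?C (0, 0) \<union> ?C (1, 0) \<union> ?C (0, -1) \<union> ?C (1, -1) = verts ?i"
    by auto
  also have "(\<Sum>z\<in>verts ?i. ?r z) =
      (\<Sum>z\<in>{z \<in> verts ?i. pt k ?i z \<in> S2 k h (S1 k h S)}. retract_chain k ?i z)"
    by (rule sum.mono_neutral_cong_right) (auto simp: rgate_def)
  finally have r: "(\<Sum>b\<in>verts i. ?r (b + b + (0, 0)) + ?r (b + b + (1, 0)) + ?r (b + b + (0, -1)) + ?r (b + b + (1, -1))) =
      (\<Sum>z\<in>{z \<in> verts ?i. pt k ?i z \<in> S2 k h (S1 k h S)}. retract_chain k ?i z)" .
  have n0: "nullhom k ((\<Sum>z\<in>{z \<in> verts ?i. pt k ?i z \<in> S2 k h (S1 k h S)}. retract_chain k ?i z) +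
      (\<Sum>z\<in>{z \<in> verts ?i. pt k ?i z \<in> S2 k h (S1 k h S)}. retract k ?i z))"
    using assms(1) by (intro nullhom_sum_cong nullhom_retract_chain) auto
  have n2: "nullhom k ((\<Sum>b\<in>verts i. gate k ?i 2 S (b + b + (1, -1)) + gate k ?i 2 S (b + b + (2, -1))) +
     (\<Sum>l\<in>jumps k ?i 2 S. lchain k ?i l))"
    using assms(1) by (rule nullhom_gates) (auto simp: jump_source_def)
  have n3: "nullhom k ((\<Sum>b\<in>verts i. gate k ?i 3 (S1 k h S) (b + b + (0, -1)) + gate k ?i 3 (S1 k h S) (b + b + (1, -1))) +
     (\<Sum>l\<in>jumps k ?i 3 (S1 k h S). lchain k ?i l))"
    using assms(1) by (rule nullhom_gates) (auto simp: jump_source_def)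
  have n4: "nullhom k ((\<Sum>b\<in>verts i. gate k ?i 4 (S1 k h S) (b + b + (1, 0)) + gate k ?i 4 (S1 k h S) (b + b + (1, -1))) +
     (\<Sum>l\<in>jumps k ?i 4 (S1 k h S). lchain k ?i l))"
    using assms(1) by (rule nullhom_gates) (auto simp: jump_source_def)
  note n = nullhom_add[OF n2 nullhom_add[OF n3 nullhom_add[OF n4 n0]]]
  have red: "ind (reduce k ?i S) =
    (\<Sum>b\<in>verts i. gate k ?i 2 S (b + b + (1, -1)) + gate k ?i 2 S (b + b + (2, -1))) +
    (\<Sum>b\<in>verts i. gate k ?i 3 (S1 k h S) (b + b + (0, -1)) + gate k ?i 3 (S1 k h S) (b + b + (1, -1))) +
    (\<Sum>b\<in>verts i. gate k ?i 4 (S1 k h S) (b + b + (1, 0)) + gate k ?i 4 (S1 k h S) (b + b + (1, -1))) +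
    (\<Sum>z\<in>{z \<in> verts ?i. pt k ?i z \<in> S2 k h (S1 k h S)}. retract_chain k ?i z)"
    unfolding ind_reduce[OF assms(1)] flips_gates
    unfolding h_def[symmetric] sum.distrib[symmetric] r[symmetric] by (rule refl)
  show ?thesis
    unfolding red using n by (simp only: char2)
qed

section \<open>Jumps as a matching of their end points\<close>

lemma oth_involution: "t \<in> {2, 3, 4} \<Longrightarrow> oth (oth z t) t = z"
  by (auto simp: oth_def xpartner_def ypartner_def prod_eq_iff)

lemma jump_source_oth: "t \<in> {2, 3, 4} \<Longrightarrow> jump_source t (oth z t) \<longleftrightarrow> \<not> jump_source t z"
  by (auto simp: oth_def xpartner_def ypartner_def jump_source_def)

lemma jump_source_nrm: "1 \<le> i \<Longrightarrow> jump_source t (nrm i z) \<longleftrightarrow> jump_source t z"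
  by (simp add: jump_source_def even_nrm)

lemma nrm_oth_involution:
  assumes "1 \<le> i" "t \<in> {2, 3, 4}" "z \<in> verts i"
  shows "nrm i (oth (nrm i (oth z t)) t) = z"
  using nrm_oth_nrm[OF assms(1), of "oth z t" t] oth_involution[OF assms(2), of z] assms(3) by simp

lemma jump_ends_oth:
  assumes "1 \<le> i" "i \<le> k" "t \<in> {2, 3, 4}" "z \<in> jump_ends k i t T"
  shows "nrm i (oth z t) \<in> jump_ends k i t T"
proof -
  have "pt k i (oth (nrm i (oth z t)) t) = pt k i z"
    using pt_oth[OF assms(1,2), of "nrm i (oth z t)" "oth z t" t] assms(2) oth_involution[OF assms(3)] by simp
  then show ?thesis
    using assms by (simp add: jump_ends_def)
qed

lemma bij_jump_ends:
  assumes "1 \<le> i" "i \<le> k" "t \<in> {2, 3, 4}"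
  shows "bij_betw (\<lambda>z. nrm i (oth z t)) {z \<in> jump_ends k i t T. jump_source t z}
    {z \<in> jump_ends k i t T. \<not> jump_source t z}"
proof (rule bij_betw_byWitness[where f' = "\<lambda>z. nrm i (oth z t)"])
  have v: "z \<in> verts i" if "z \<in> jump_ends k i t T" for z
    using that by (simp add: jump_ends_def)
  show "\<forall>z\<in>{z \<in> jump_ends k i t T. jump_source t z}. nrm i (oth (nrm i (oth z t)) t) = z"
    "\<forall>z\<in>{z \<in> jump_ends k i t T. \<not> jump_source t z}. nrm i (oth (nrm i (oth z t)) t) = z"
    using nrm_oth_involution[OF assms(1,3)] v by blast+
  show "(\<lambda>z. nrm i (oth z t)) ` {z \<in> jump_ends k i t T. jump_source t z} \<subseteq> {z \<in> jump_ends k i t T. \<not> jump_source t z}"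
    "(\<lambda>z. nrm i (oth z t)) ` {z \<in> jump_ends k i t T. \<not> jump_source t z} \<subseteq> {z \<in> jump_ends k i t T. jump_source t z}"
    using jump_ends_oth[OF assms] jump_source_oth[OF assms(3)] jump_source_nrm[OF assms(1)] by blast+
qed

lemma finite_jump_ends [simp]: "finite (jump_ends k i t T)"
  by (simp add: jump_ends_def)

lemma jumps_eq: "jumps k i t T = {z \<in> jump_ends k i t T. jump_source t z} \<times> {t}"
  by (auto simp: jumps_def jump_ends_def)

lemma jump_ends_split:
  "jump_ends k i t T = {z \<in> jump_ends k i t T. jump_source t z} \<union> {z \<in> jump_ends k i t T. \<not> jump_source t z}"
  by blast

lemma card_jump_ends:
  assumes "1 \<le> i" "i \<le> k" "t \<in> {2, 3, 4}"
  shows "card (jump_ends k i t T) = 2 * card (jumps k i t T)"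
proof -
  have "card (jump_ends k i t T) = card {z \<in> jump_ends k i t T. jump_source t z}
      + card {z \<in> jump_ends k i t T. \<not> jump_source t z}"
    by (subst jump_ends_split) (rule card_Un_disjoint; auto)
  then show ?thesis
    using bij_betw_same_card[OF bij_jump_ends[OF assms, of T]] by (simp add: jumps_eq card_cartesian_product)
qed

lemma boundary_jumps:
  assumes "1 \<le> i" "i \<le> k" "t \<in> {2, 3, 4}"
  shows "(\<Sum>l\<in>jumps k i t T. lbd i l) = ind (jump_ends k i t T)"
proof -
  let ?A = "{z \<in> jump_ends k i t T. jump_source t z}" and ?B = "{z \<in> jump_ends k i t T. \<not> jump_source t z}"
  have fin: "finite ?A" "finite ?B" by auto
  have "(\<Sum>l\<in>jumps k i t T. lbd i l) = (\<Sum>z\<in>?A. lbd i (z, t))"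
    unfolding jumps_eq by (simp add: sum.cartesian_product')
  also have "\<dots> = (\<Sum>z\<in>?A. ind {z}) + (\<Sum>z\<in>?A. ind {nrm i (oth z t)})"
    by (simp add: lbd_def sum.distrib)
  also have "(\<Sum>z\<in>?A. ind {nrm i (oth z t)}) = (\<Sum>z\<in>?B. ind {z})"
    by (rule sum.reindex_bij_betw[OF bij_jump_ends[OF assms]])
  also have "(\<Sum>z\<in>?A. ind {z}) + (\<Sum>z\<in>?B. ind {z}) = ind (?A \<union> ?B)"
    unfolding ind_eq_sum[OF fin(1), symmetric] ind_eq_sum[OF fin(2), symmetric]
    by (rule ind_disjoint_Un[symmetric]) auto
  finally show ?thesis
    using jump_ends_split[of k i t T] by simp
qed

text \<open>The third claim is the uniqueness behind the matching: among the jumps of one type, an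
  end point v determines the jump, which starts at v or at its partner, whichever is a
  source.\<close>

lemma lends_jumps:
  assumes "1 \<le> i" "i \<le> k" "t \<in> {2, 3, 4}" "l \<in> jumps k i t T"
  shows "snd l = t" "lends i l \<subseteq> jump_ends k i t T"
    "v \<in> lends i l \<Longrightarrow> fst l = (if jump_source t v then v else nrm i (oth v t))"
proof -
  obtain z where z: "l = (z, t)" "z \<in> jump_ends k i t T" "jump_source t z" "z \<in> verts i"
    using assms(4) unfolding jumps_eq by (auto simp: jump_ends_def)
  then show "snd l = t" "lends i l \<subseteq> jump_ends k i t T"
    using jump_ends_oth[OF assms(1-3) z(2)] by (auto simp: lends_def)
  show "fst l = (if jump_source t v then v else nrm i (oth v t))" if "v \<in> lends i l"
    using that z nrm_oth_involution[OF assms(1,3) z(4)] jump_source_oth[OF assms(3), of z]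
      jump_source_nrm[OF assms(1), of t "oth z t"]
    by (auto simp: lends_def)
qed

section \<open>One reduction step\<close>

lemma syn_cpath:
  assumes "1 \<le> k" "i \<le> k"
  shows "syn k (cpath k i z) = ind {pt k i 0} + ind {pt k i z}"
proof -
  let ?R = "\<lambda>z. syn k (cpath k i z) + ind {pt k i z}"
  have step: "?R (z + dir d) = ?R z" if "d \<in> {0, 1}" for z d
    using syn_nullhom[OF assms(1) nullhom_seg[OF assms that, of z]] syn_seg[OF assms that, of z]
    by (simp add: syn_add) (metis (no_types, lifting) add.assoc add.commute add_self_left add.right_neutral)
  have x: "?R (a, 0) = ?R (0, 0)" for a
  proof (induction a rule: int_induct[of _ 0])
    case base
    show ?case ..
  next
    case (step1 j)
    then show ?case using step[of 0 "(j, 0)"] by (simp add: dir_def)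
  next
    case (step2 j)
    then show ?case using step[of 0 "(j - 1, 0)"] by (simp add: dir_def)
  qed
  have "?R (a, b) = ?R (a, 0)" for a b
  proof (induction b rule: int_induct[of _ 0])
    case base
    show ?case ..
  next
    case (step1 j)
    then show ?case using step[of 1 "(a, j)"] by (simp add: dir_def)
  next
    case (step2 j)
    then show ?case using step[of 1 "(a, j - 1)"] by (simp add: dir_def)
  qed
  then have "?R (fst z, snd z) = ?R (0, 0)"
    using x by (rule trans)
  moreover have "cpath k i (0, 0) = 0"
    by (simp add: cpath_def)
  ultimately have "?R z = ind {pt k i 0}"
    by (simp add: zero_prod_def)
  then show ?thesis
    by (metis add.commute add_self_left)
qed

lemma sum_ends:
  assumes "1 \<le> i" "i \<le> k" "X \<subseteq> verts i \<times> UNIV"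
  shows "(\<Sum>l\<in>X. ind {pt k i (fst l)} + ind {pt k i (oth (fst l) (snd l))}) = ind (pt k i ` odd_verts i X)"
proof
  fix w
  have ind_pt: "ind {pt k i (fst l)} (pt k i v) + ind {pt k i (oth (fst l) (snd l))} (pt k i v) = lbd i l v"
    if "v \<in> verts i" "l \<in> X" for v l
    using that assms(3) by (auto simp: ind_def lbd_def plus_fun_apply pt_eq_iff[OF assms(2)])
  show "(\<Sum>l\<in>X. ind {pt k i (fst l)} + ind {pt k i (oth (fst l) (snd l))}) w = ind (pt k i ` odd_verts i X) w"
  proof (cases "w \<in> pt k i ` verts i")
    case True
    then obtain v where v: "v \<in> verts i" "w = pt k i v" by blast
    have "w \<in> pt k i ` odd_verts i X \<longleftrightarrow> v \<in> odd_verts i X"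
      using v odd_verts_subset[OF assms(3)] pt_eq_iff[OF assms(2)] by (metis image_iff nrm_id subsetD)
    then have "ind (pt k i ` odd_verts i X) w = (\<Sum>l\<in>X. lbd i l) v"
      unfolding ind_odd_verts[symmetric] by (simp add: ind_def)
    also have "\<dots> = (\<Sum>l\<in>X. ind {pt k i (fst l)} w + ind {pt k i (oth (fst l) (snd l))} w)"
      unfolding sum_fun_apply v(2) using ind_pt[OF v(1)] by (intro sum.cong) simp_all
    finally show ?thesis
      unfolding sum_fun_apply plus_fun_apply by simp
  next
    case False
    have ne: "w \<noteq> pt k i z" for z
      using False pt_nrm[OF assms(2), of z] by (metis image_eqI nrm_in_verts)
    then have "(\<Sum>l\<in>X. ind {pt k i (fst l)} w + ind {pt k i (oth (fst l) (snd l))} w) = 0"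
      by (intro sum.neutral) (simp add: ind_def ne)
    moreover have "w \<notin> pt k i ` odd_verts i X"
      using False odd_verts_subset[OF assms(3)] by blast
    ultimately show ?thesis
      unfolding sum_fun_apply plus_fun_apply by (simp add: ind_def)
  qed
qed

lemma syn_lchain:
  assumes "1 \<le> i" "i \<le> k"
  shows "syn k (lchain k i l) = ind {pt k i (fst l)} + ind {pt k i (oth (fst l) (snd l))}"
proof -
  have "1 \<le> k" using assms by simp
  then show ?thesis
    by (simp add: lchain_def syn_add syn_cpath[OF _ assms(2)] char2)
qed

lemma syn_emb:
  assumes "1 \<le> i" "i \<le> k" "F \<subseteq> edges i"
  shows "syn k (emb k i F) = ind (pt k i ` odd_verts i F)"
proof -
  have k: "1 \<le> k" using assms by simp
  have "syn k (emb k i F) = (\<Sum>l\<in>F. ind {pt k i (fst l)} + ind {pt k i (oth (fst l) (snd l))})"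
    unfolding emb_def syn_sum
  proof (rule sum.cong)
    fix l assume "l \<in> F"
    then have "snd l \<in> {0, 1}"
      using assms(3) by (auto simp: edges_def)
    then show "syn k (seg k i (fst l) (snd l)) = ind {pt k i (fst l)} + ind {pt k i (oth (fst l) (snd l))}"
      using syn_seg[OF k assms(2)] by (auto simp: oth_def)
  qed simp
  also have "\<dots> = ind (pt k i ` odd_verts i F)"
    using assms by (intro sum_ends) (auto simp: edges_def)
  finally show ?thesis .
qed

lemma nullhom_emb:
  assumes "1 \<le> i" "i \<le> k" "F \<subseteq> edges i"
  shows "nullhom k (emb k i F + (\<Sum>l\<in>F. lchain k i l))"
  unfolding emb_def
proof (rule nullhom_sum_cong)
  fix l assume "l \<in> F"
  then have "snd l \<in> {0, 1}"
    using assms(3) by (auto simp: edges_def)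
  then show "nullhom k (seg k i (fst l) (snd l) + lchain k i l)"
    using nullhom_seg[of k i "snd l" "fst l"] assms by (auto simp: lchain_def oth_def)
qed

lemma same_D_cases:
  assumes "same_D z w"
  shows "w = z \<or> w = oth z 2 \<or> w = oth z 3 \<or> w = oth z 4"
proof -
  have x: "x' = x \<or> x' = xpartner x" if "half (x + 1) = half (x' + 1)" for x x'
    using that unfolding half_def xpartner_def by presburger
  have y: "y' = y \<or> y' = ypartner y" if "half y = half y'" for y y'
    using that unfolding half_def ypartner_def by presburger
  show ?thesis
    using assms x[of "fst z" "fst w"] y[of "snd z" "snd w"]
    by (auto simp: same_D_def oth_def prod_eq_iff)
qed

text \<open>With J the set of jumps and U the unmatched vertices, |X| = |F| + |J| and |S| = 2 |J| +
  |U|. Then 12 n + |U| <= 10 |X| becomes 12 n + 6 |U| <= 5 (2 |F| + |S|), and the new syndrome, made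
  of parents of U, has at most |U| elements.\<close>

lemma reduction_step:
  assumes i: "Suc i \<le> k" and F: "F \<subseteq> edges (Suc i)" and S: "ind S = syn k (emb k (Suc i) F)"
  shows "\<exists>F'\<subseteq>edges i. \<exists>S'. ind S' = syn k (emb k i F') \<and>
    nullhom k (emb k (Suc i) F + ind (reduce k (Suc i) S) + emb k i F') \<and>
    6 * (2 * card F' + card S') \<le> 5 * (2 * card F + card S)"
proof -
  let ?i = "Suc i"
  let ?p = "pt k ?i"
  have i1: "1 \<le> ?i" and k1: "1 \<le> k" using i by auto
  define h where "h = hh k ?i"
  define T where "T = S1 k h S"
  define U where "U = {z \<in> verts ?i. ?p z \<in> S2 k h T}"
  define Sl where "Sl = odd_verts ?i F"
  define X where "X = F \<union> (jumps k ?i 2 S \<union> (jumps k ?i 3 T \<union> jumps k ?i 4 T))"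
  let ?P2 = "jump_ends k ?i 2 S" and ?P3 = "jump_ends k ?i 3 T" and ?P4 = "jump_ends k ?i 4 T"
  have F': "F \<subseteq> verts ?i \<times> UNIV" "finite F"
    using F finite_subset[OF F finite_edges] by (auto simp: edges_def)
  have Ftag: "snd l < 2" if "l \<in> F" for l
    using that F by (auto simp: edges_def)
  have SlV: "Sl \<subseteq> verts ?i"
    unfolding Sl_def by (rule odd_verts_subset[OF F'(1)])
  have S_eq: "S = ?p ` Sl"
    using S unfolding syn_emb[OF i1 i F] ind_inject Sl_def .
  have inj: "inj_on ?p (verts ?i)"
    by (rule inj_onI) (simp add: pt_eq_iff[OF i])
  have cardS: "card S = card Sl"
    unfolding S_eq by (rule card_image[OF inj_on_subset[OF inj SlV]])
  have memS: "?p z \<in> S \<longleftrightarrow> z \<in> Sl" if "z \<in> verts ?i" for z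
    unfolding S_eq using inj_on_image_mem_iff[OF inj that SlV] .
  have memT: "?p z \<in> T \<longleftrightarrow> ?p z \<in> S \<and> ?p (oth z 2) \<notin> S" for z
    unfolding T_def h_def by (rule pt_in_S1[OF i])
  have memU: "?p z \<in> S2 k h T \<longleftrightarrow> ?p z \<in> T \<and> ?p (oth z 3) \<notin> T \<and> ?p (oth z 4) \<notin> T" for z
    unfolding h_def by (rule pt_in_S2[OF i])
  \<comment> \<open>If a vertex had both its vertical and its horizontal partner in T, these two
    would be a diagonal pair, which step 1 removes. Hence step 2 also yields a matching.\<close>
  have diag: "oth (oth z 3) 2 = oth z 4" for z
    by (simp add: oth_def xpartner_def ypartner_def)
  have P34: "?P3 \<inter> ?P4 = {}"
    unfolding jump_ends_def using memT[of "oth _ 3"] memT[of "oth _ 4"] diag by auto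
  have P2T: "?P2 \<inter> {z \<in> verts ?i. ?p z \<in> T} = {}"
    unfolding jump_ends_def using memT by blast
  have P3T: "?P3 \<subseteq> {z \<in> verts ?i. ?p z \<in> T}" "?P4 \<subseteq> {z \<in> verts ?i. ?p z \<in> T}"
    by (auto simp: jump_ends_def)
  have UT: "U \<subseteq> {z \<in> verts ?i. ?p z \<in> T}"
    unfolding U_def using memU by blast
  have U34: "U \<inter> ?P3 = {}" "U \<inter> ?P4 = {}"
    unfolding U_def jump_ends_def using memU by blast+
  have Sl_split: "Sl = ?P2 \<union> (?P3 \<union> (?P4 \<union> U))"
  proof -
    have "z \<in> Sl \<longleftrightarrow> z \<in> ?P2 \<union> (?P3 \<union> (?P4 \<union> U))" if "z \<in> verts ?i" for z
      using that memS[OF that] memT[of z] memU[of z] unfolding U_def jump_ends_def by blast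
    moreover have "?P2 \<union> (?P3 \<union> (?P4 \<union> U)) \<subseteq> verts ?i"
      by (auto simp: jump_ends_def U_def)
    ultimately show ?thesis
      using SlV by blast
  qed
  have disj: "?P2 \<inter> (?P3 \<union> (?P4 \<union> U)) = {}" "?P3 \<inter> (?P4 \<union> U) = {}" "?P4 \<inter> U = {}"
    using P2T P3T UT U34 P34 by blast+
  have finU: "finite U" by (simp add: U_def)
  have ind_Sl: "ind Sl = ind ?P2 + (ind ?P3 + (ind ?P4 + ind U))"
    unfolding Sl_split by (simp only: ind_disjoint_Un disj)
  have tags: "\<And>l T. l \<in> jumps k ?i 2 T \<Longrightarrow> snd l = 2" "\<And>l T. l \<in> jumps k ?i 3 T \<Longrightarrow> snd l = 3"
    "\<And>l T. l \<in> jumps k ?i 4 T \<Longrightarrow> snd l = 4"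
    by (auto simp: jumps_def)
  have Xdisj: "F \<inter> (jumps k ?i 2 S \<union> (jumps k ?i 3 T \<union> jumps k ?i 4 T)) = {}"
    "jumps k ?i 2 S \<inter> (jumps k ?i 3 T \<union> jumps k ?i 4 T) = {}" "jumps k ?i 3 T \<inter> jumps k ?i 4 T = {}"
    using tags Ftag by fastforce+
  note sum_Un = sum.union_disjoint[OF F'(2) _ Xdisj(1)] sum.union_disjoint[OF finite_jumps _ Xdisj(2)]
    sum.union_disjoint[OF finite_jumps finite_jumps Xdisj(3)]
  have finX: "finite X" and XV: "X \<subseteq> verts ?i \<times> UNIV"
    using F' by (auto simp: X_def jumps_def)
  have sum_lbd: "(\<Sum>l\<in>X. lbd ?i l) = (\<Sum>l\<in>F. lbd ?i l) + ((\<Sum>l\<in>jumps k ?i 2 S. lbd ?i l) +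
      ((\<Sum>l\<in>jumps k ?i 3 T. lbd ?i l) + (\<Sum>l\<in>jumps k ?i 4 T. lbd ?i l)))"
    unfolding X_def by (simp add: sum_Un)
  have sum_lchain: "(\<Sum>l\<in>X. lchain k ?i l) = (\<Sum>l\<in>F. lchain k ?i l) + ((\<Sum>l\<in>jumps k ?i 2 S. lchain k ?i l) +
      ((\<Sum>l\<in>jumps k ?i 3 T. lchain k ?i l) + (\<Sum>l\<in>jumps k ?i 4 T. lchain k ?i l)))"
    unfolding X_def by (simp add: sum_Un)
  have cardX: "card X = card F + (card (jumps k ?i 2 S) + (card (jumps k ?i 3 T) + card (jumps k ?i 4 T)))"
    unfolding X_def using card_Un_disjoint[OF F'(2) _ Xdisj(1)] card_Un_disjoint[OF finite_jumps _ Xdisj(2)]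
      card_Un_disjoint[OF finite_jumps finite_jumps Xdisj(3)] by simp
  have "ind (odd_verts ?i X) = ind U"
    unfolding ind_odd_verts sum_lbd using boundary_jumps[OF i1 i] ind_Sl
    unfolding Sl_def ind_odd_verts by (simp add: char2)
  then have oddX: "odd_verts ?i X = U"
    by (simp only: ind_inject)
  define TT where "TT t = (if t = 2 then S else T)" for t :: nat
  have jumpX: "snd l \<in> {2, 3, 4} \<and> l \<in> jumps k ?i (snd l) (TT (snd l))" if "l \<in> X" "2 \<le> snd l" for l
  proof -
    from that Ftag[of l] consider "l \<in> jumps k ?i 2 S" | "l \<in> jumps k ?i 3 T" | "l \<in> jumps k ?i 4 T"
      by (auto simp: X_def)
    then show ?thesis
      using tags by cases (simp_all add: TT_def)
  qed
  have ends_disj: "t = t'" if "v \<in> jump_ends k ?i t (TT t)" "v \<in> jump_ends k ?i t' (TT t')"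
      "t \<in> {2, 3, 4}" "t' \<in> {2, 3, 4}" for v t t'
    using that disj by (auto simp: TT_def)
  have ends_U: "jump_ends k ?i t (TT t) \<inter> U = {}" if "t \<in> {2, 3, 4}" for t
    using that disj by (auto simp: TT_def)
  have "\<exists>n. rep k i n ((\<Sum>l\<in>X. lchain k ?i l) + (\<Sum>u\<in>odd_verts ?i X. retract k ?i u)) \<and>
      12 * n + card (odd_verts ?i X) \<le> 10 * card X"
  proof (rule trail_decomposition[OF i finX XV])
    fix l l' assume l: "l \<in> X" "l' \<in> X" "2 \<le> snd l" "2 \<le> snd l'" and "lends ?i l \<inter> lends ?i l' \<noteq> {}"
    then obtain v where v: "v \<in> lends ?i l" "v \<in> lends ?i l'" by blast
    note j = jumpX[OF l(1,3)] and j' = jumpX[OF l(2,4)]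
    have t: "snd l = snd l'"
      using v lends_jumps(2)[OF i1 i, of "snd l" l] lends_jumps(2)[OF i1 i, of "snd l'" l'] j j'
      by (intro ends_disj[of v]) blast+
    note e = lends_jumps(3)[OF i1 i conjunct1[OF j] conjunct2[OF j] v(1)]
      and e' = lends_jumps(3)[OF i1 i conjunct1[OF j'] conjunct2[OF j'] v(2)]
    from e e' have "fst l = fst l'"
      unfolding t by simp
    with t show "l = l'"
      by (simp add: prod_eq_iff)
  next
    fix l assume l: "l \<in> X" "2 \<le> snd l"
    then show "lends ?i l \<inter> odd_verts ?i X = {}"
      using jumpX[OF l] lends_jumps(2)[OF i1 i, of "snd l" l] ends_U[of "snd l"] unfolding oddX by blast
  next
    fix z w assume zw: "nrm ?i z \<in> odd_verts ?i X" "nrm ?i w \<in> odd_verts ?i X" "same_D z w"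
    then have "?p z \<in> S2 k h T" "?p w \<in> S2 k h T"
      unfolding oddX U_def using pt_nrm[OF i] by auto
    \<comment> \<open>Two leftover vertices of one D cell that were partners of any kind would have
      been matched in step 1 or 2.\<close>
    then have "w \<noteq> oth z 2" "w \<noteq> oth z 3" "w \<noteq> oth z 4"
      using memU memT by metis+
    then show "nrm ?i z = nrm ?i w"
      using same_D_cases[OF zw(3)] by blast
  qed
  then obtain n F' where n: "12 * n + card U \<le> 10 * card X"
    and F'': "F' \<subseteq> edges i" "card F' \<le> n"
      "nullhom k ((\<Sum>l\<in>X. lchain k ?i l) + (\<Sum>u\<in>U. retract k ?i u) + emb k i F')"
    unfolding oddX rep_def by blast
  have nh: "nullhom k (emb k ?i F + ind (reduce k ?i S) + emb k i F')"
    using nullhom_add[OF nullhom_emb[OF i1 i F] nullhom_add[OF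
        nullhom_reduce[OF i, of S, folded h_def, folded T_def, folded U_def] F''(3)]]
    unfolding sum_lchain by (simp add: char2)
  define S' where "S' = {v. syn k (emb k i F') v = 1}"
  let ?q = "\<lambda>u. ?p (par u + par u)"
  \<comment> \<open>The boundaries of the trails and of the retractions cancel on U and leave the
    retracted points. Several u may share a parent, so only an inequality of cardinalities
    follows.\<close>
  have "syn k (emb k i F') = (\<Sum>u\<in>U. ind {?q u})"
  proof -
    have "U \<subseteq> verts ?i" by (auto simp: U_def)
    then have inj: "inj_on ?p U"
      by (rule inj_on_subset[OF inj])
    have "ind (?p ` U) = (\<Sum>u\<in>U. ind {?p u})"
      unfolding ind_eq_sum[OF finite_imageI[OF finU]] sum.reindex[OF inj] by simp
    moreover have "syn k (\<Sum>l\<in>X. lchain k ?i l) = ind (?p ` U)"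
      unfolding syn_sum syn_lchain[OF i1 i] sum_ends[OF i1 i XV] oddX ..
    moreover have "syn k (\<Sum>u\<in>U. retract k ?i u) = (\<Sum>u\<in>U. ind {?p u} + ind {?q u})"
      unfolding syn_sum retract_def syn_add syn_cpath[OF k1 i] by (simp add: char2)
    moreover have "syn k (\<Sum>l\<in>X. lchain k ?i l) + syn k (\<Sum>u\<in>U. retract k ?i u) + syn k (emb k i F') = 0"
      using syn_nullhom[OF k1 F''(3)] by (simp only: syn_add)
    ultimately have "(\<Sum>u\<in>U. ind {?q u}) + syn k (emb k i F') = 0"
      by (simp add: sum.distrib char2)
    then show ?thesis
      by (rule add_eq_0_char2[symmetric])
  qed
  moreover have "\<exists>u\<in>U. v = ?q u" if "(\<Sum>u\<in>U. ind {?q u}) v = 1" for v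
  proof (rule ccontr)
    assume "\<not> (\<exists>u\<in>U. v = ?q u)"
    then have "(\<Sum>u\<in>U. ind {?q u} v) = 0"
      by (intro sum.neutral) (auto simp: ind_def)
    with that show False by (simp add: sum_fun_apply)
  qed
  ultimately have "S' \<subseteq> ?q ` U"
    unfolding S'_def by auto
  then have cardS': "card S' \<le> card U"
    using card_mono[OF finite_imageI[OF finU], of S' ?q] card_image_le[OF finU, of ?q] by linarith
  have "card Sl = card ?P2 + (card ?P3 + (card ?P4 + card U))"
    unfolding Sl_split using disj finU by (simp add: card_Un_disjoint)
  then have "card S = 2 * (card (jumps k ?i 2 S) + (card (jumps k ?i 3 T) + card (jumps k ?i 4 T))) + card U"
    unfolding cardS using card_jump_ends[OF i1 i] by simp
  moreover have "6 * (2 * f' + s') \<le> 5 * (2 * f + s)"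
    if "12 * n + u \<le> 10 * x" "f' \<le> n" "s' \<le> u" "x = f + j" "s = 2 * j + u" for f f' s s' u x j n :: nat
    using that by simp
  ultimately have "6 * (2 * card F' + card S') \<le> 5 * (2 * card F + card S)"
    using n F''(2) cardS' cardX by blast
  moreover have "ind S' = syn k (emb k i F')"
    unfolding S'_def by (rule ind_support)
  ultimately show ?thesis
    using nh F''(1) by blast
qed

section \<open>The decoder\<close>

lemma syndrome_empty: "syndrome k {} = {}"
  by (simp add: syndrome_def)

lemma reduce_empty: "reduce k i {} = {}"
proof -
  have "S1 k h {} = {}" "S2 k h {} = {}" for h
    by (simp_all add: S1_def S2_def)
  then have "flips k h {} x = []" for h x
    by (simp add: flips_def flips1_def flips2_def flips3_def Let_def)
  then show ?thesis
    by (simp add: reduce_def Let_def)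
qed

lemma dec_loop_empty: "dec_loop k j {} e = e"
  by (cases j) simp_all

text \<open>The early exit changes no result: from an empty syndrome \<open>reduce\<close> flips
  nothing and the syndrome stays empty.\<close>

lemma dec_loop_Suc:
  "dec_loop k (Suc j) S e = dec_loop k j (symdiff S (syndrome k (reduce k (Suc j) S)))
     (symdiff e (reduce k (Suc j) S))"
  by (cases "S = {}") (simp_all add: reduce_empty syndrome_empty symdiff_def dec_loop_empty Let_def)

lemma reduce_subset: "reduce k i S \<subseteq> edges k"
  by (auto simp: reduce_def Let_def)

text \<open>A single edge has two distinct ends and already reaches 2 + 2 = 4; two edges reach 4
  without their syndrome.\<close>

lemma light_error_at_level_1:
  assumes "1 \<le> k" "F \<subseteq> edges 1" "ind S = syn k (emb k 1 F)" "2 * card F + card S < 4"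
  shows "F = {}"
proof (rule ccontr)
  assume "F \<noteq> {}"
  have "finite F"
    by (rule finite_subset[OF assms(2) finite_edges])
  then have "card F = 1"
    using \<open>F \<noteq> {}\<close> assms(4) card_gt_0_iff[of F] by linarith
  then obtain f where f: "F = {f}"
    by (auto simp: card_1_singleton_iff)
  then have d: "snd f \<in> {0, 1}"
    using assms(2) by (auto simp: edges_def)
  let ?a = "pt k 1 (fst f)" and ?b = "pt k 1 (fst f + dir (snd f))"
  have "?a \<noteq> ?b"
    using nrm_dir_neq[of 1 "fst f" "snd f"] pt_eq_iff[OF assms(1)] by simp
  have "ind S = ind {?a} + ind {?b}"
    unfolding assms(3) f emb_def using syn_seg[OF assms(1,1) d] by simp
  also have "\<dots> = ind {?a, ?b}"
    using \<open>?a \<noteq> ?b\<close> by (intro ind_insert[symmetric]) simp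
  finally have "S = {?a, ?b}"
    by (simp only: ind_inject)
  then have "card S = 2"
    using \<open>?a \<noteq> ?b\<close> by simp
  with assms(4) \<open>card F = 1\<close> show False by simp
qed

text \<open>F stands for the error that remains, up to homology, when the loop reaches T_j; the
  decoder sees only its syndrome. The claim is that the corrections still to be added to e are
  homologous to F.\<close>

lemma dec_loop_correct:
  assumes "1 \<le> j" "j \<le> k" "F \<subseteq> edges j" "ind S = syn k (emb k j F)"
    and "real (2 * card F + card S) < 4 * (6 / 5) ^ (j - 1)"
  shows "nullhom k (emb k j F + (ind e + ind (dec_loop k j S e)))"
  using assms
proof (induction j arbitrary: F S e rule: nat_induct_at_least)
  case base
  have "2 * card F + card S < 4"
    using base(4) by simp
  then have "F = {}"
    using light_error_at_level_1 base by blast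
  then have "ind S = ind {}"
    using base(3) by (simp add: emb_def)
  then have "S = {}"
    by (simp only: ind_inject)
  then show ?case
    using \<open>F = {}\<close> by (simp add: emb_def)
next
  case (Suc j)
  let ?r = "reduce k (Suc j) S"
  obtain F' S' where F': "F' \<subseteq> edges j" "ind S' = syn k (emb k j F')"
    "nullhom k (emb k (Suc j) F + ind ?r + emb k j F')"
    "6 * (2 * card F' + card S') \<le> 5 * (2 * card F + card S)"
    using reduction_step[OF Suc.prems(1-3)] by blast
  have k: "1 \<le> k" using Suc.prems(1) by simp
  have "syn k (emb k (Suc j) F) + syn k (ind ?r) + syn k (emb k j F') = 0"
    using syn_nullhom[OF k F'(3)] by (simp only: syn_add)
  then have "ind (symdiff S (syndrome k ?r)) = ind S'"
    unfolding ind_symdiff ind_syndrome[OF reduce_subset] Suc.prems(3) F'(2) by (rule add_eq_0_char2)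
  then have S': "symdiff S (syndrome k ?r) = S'"
    by (simp only: ind_inject)
  have "real (6 * (2 * card F' + card S')) \<le> real (5 * (2 * card F + card S))"
    using F'(4) by (simp only: of_nat_le_iff)
  then have "real (2 * card F' + card S') \<le> 5 / 6 * real (2 * card F + card S)"
    by simp
  also have "\<dots> < 5 / 6 * (4 * (6 / 5) ^ (Suc j - 1))"
    using Suc.prems(4) by simp
  also have "\<dots> = 4 * (6 / 5) ^ (j - 1)"
    using Suc.hyps by (cases j) simp_all
  finally have "nullhom k (emb k j F' + (ind (symdiff e ?r) + ind (dec_loop k j S' (symdiff e ?r))))"
    using Suc.IH[of F' S' "symdiff e ?r"] Suc.prems(1) F' by simp
  from nullhom_add[OF F'(3) this] show ?case
    unfolding dec_loop_Suc S' by (simp add: ind_symdiff char2)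
qed

lemma card_syndrome_le:
  assumes "1 \<le> k" "e \<subseteq> edges k"
  shows "card (syndrome k e) \<le> 2 * card e"
proof -
  have fin: "finite e"
    by (rule finite_subset[OF assms(2) finite_edges])
  have "syndrome k e \<subseteq> (\<Union>f\<in>e. ends k f)"
  proof
    fix v assume "v \<in> syndrome k e"
    then have "card {f \<in> e. v \<in> ends k f} \<noteq> 0"
      by (auto simp: syndrome_def intro: ccontr)
    then have "{f \<in> e. v \<in> ends k f} \<noteq> {}"
      by (metis card.empty)
    then show "v \<in> (\<Union>f\<in>e. ends k f)" by blast
  qed
  then have "card (syndrome k e) \<le> card (\<Union>f\<in>e. ends k f)"
    using fin by (intro card_mono) (auto simp: ends_def)
  also have "\<dots> \<le> (\<Sum>f\<in>e. card (ends k f))"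
    by (rule card_UN_le[OF fin])
  also have "\<dots> \<le> (\<Sum>f\<in>e. 2)"
    by (intro sum_mono) (simp add: ends_def card_insert_if)
  finally show ?thesis by simp
qed

lemma decodes_light_errors:
  assumes "1 \<le> k" "e \<subseteq> edges k" "real (card e) < (6 / 5) ^ (k - 1)"
  shows "decodes_correctly k e"
proof -
  have "real (2 * card e + card (syndrome k e)) < 4 * (6 / 5) ^ (k - 1)"
    using card_syndrome_le[OF assms(1,2)] assms(3) by simp
  then have "nullhom k (emb k k e + (ind {} + ind (dec_loop k k (syndrome k e) {})))"
    using assms(1,2) by (intro dec_loop_correct) (simp_all add: emb_self ind_syndrome)
  then have "nullhom k (ind (symdiff e (decoder k e)))"
    by (simp add: emb_self[OF assms(2)] decoder_def ind_symdiff)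
  then show ?thesis
    by (simp add: decodes_correctly_def nullhom_ind)
qed

section \<open>An error that is not decoded correctly\<close>

text \<open>The intersection number modulo 2 with a closed dual curve between the columns x = 0 and
  x = 1. It vanishes on faces, whose two horizontal edges start in the same column.\<close>

definition crossings :: "nat \<Rightarrow> (edge \<Rightarrow> bit) \<Rightarrow> bit" where
  "crossings k c = (\<Sum>y\<in>{0..<NN k}. c ((0, y), 0))"

lemma crossings_add: "crossings k (a + b) = crossings k a + crossings k b"
  unfolding crossings_def plus_fun_apply by (simp only: sum.distrib)

lemma crossings_seg: "crossings k (seg k k z d) = of_bool (d = 0 \<and> fst (nrm k z) = 0)"
proof -
  have "crossings k (seg k k z d) =
      (\<Sum>y\<in>{0..<NN k}. if y = snd (nrm k z) then of_bool (d = 0 \<and> fst (nrm k z) = 0) else 0)"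
    unfolding crossings_def seg_self by (intro sum.cong) (auto simp: ind_def prod_eq_iff)
  also have "\<dots> = of_bool (d = 0 \<and> fst (nrm k z) = 0)"
    by (subst sum.delta) (simp_all add: nrm_def)
  finally show ?thesis .
qed

lemma crossings_face_span:
  assumes "1 \<le> k" "A \<in> face_span k"
  shows "crossings k (ind A) = 0"
  using assms(2)
proof (induction rule: face_span.induct)
  case zero
  show ?case by (simp add: crossings_def zero_fun_apply)
next
  case (add A v)
  have "crossings k (square k k v) = 0"
    unfolding square_def crossings_add crossings_seg by (simp add: nrm_def dir_def)
  then show ?case
    using add ind_face[OF assms(1), of v] by (simp add: ind_symdiff crossings_add)
qed

text \<open>A horizontal loop around the torus has empty syndrome, so the decoder returns nothing,
  yet it crosses the dual curve once. It bounds the admissible weights, without which the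
  \<open>GREATEST\<close> in \<open>omega\<close> would be meaningless.\<close>

lemma undecodable_error:
  assumes "1 \<le> k"
  shows "\<exists>e\<subseteq>edges k. \<not> decodes_correctly k e"
proof -
  define e :: "edge set" where "e = (\<lambda>x. ((x, 0), 0)) ` {0..<NN k}"
  have e: "e \<subseteq> edges k"
    by (auto simp: e_def edges_def verts_def)
  have "ind e = (\<Sum>x\<in>{0..<NN k}. seg k k (x, 0) 0)"
  proof -
    have "finite e" by (simp add: e_def)
    then have "ind e = (\<Sum>f\<in>e. ind {f})" by (rule ind_eq_sum)
    also have "\<dots> = (\<Sum>x\<in>{0..<NN k}. ind {((x, 0), 0)})"
      unfolding e_def by (subst sum.reindex) (auto simp: inj_on_def)
    also have "\<dots> = (\<Sum>x\<in>{0..<NN k}. seg k k (x, 0) 0)"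
      unfolding seg_self by (intro sum.cong) (auto simp: nrm_def)
    finally show ?thesis .
  qed
  also have "\<dots> = telescope (\<lambda>x. seg k k (x, 0) 0) (NN k)"
    using less_imp_le[OF NN_pos[of k]] by (simp add: telescope_def min_absorb1 max_absorb2)
  also have "\<dots> = cpath k k (NN k, 0)"
    by (simp add: cpath_def)
  finally have "syn k (ind e) = ind {pt k k 0} + ind {pt k k (NN k, 0)}"
    using syn_cpath[OF assms order_refl] by simp
  also have "\<dots> = 0"
    by (simp add: pt_self nrm_def)
  finally have "ind (syndrome k e) = ind {}"
    unfolding ind_syndrome[OF e] by simp
  then have "decoder k e = {}"
    unfolding decoder_def ind_inject by (simp add: dec_loop_empty)
  moreover have "crossings k (ind e) = 1"
  proof -
    have "crossings k (ind e) = (\<Sum>y\<in>{0..<NN k}. if y = 0 then 1 else 0)"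
      unfolding crossings_def by (intro sum.cong) (auto simp: ind_def e_def)
    then show ?thesis by simp
  qed
  then have "e \<notin> face_span k"
    using crossings_face_span[OF assms] by auto
  ultimately have "\<not> decodes_correctly k e"
    by (simp add: decodes_correctly_def symdiff_def)
  with e show ?thesis by blast
qed

text \<open>The admissible weights from w upwards lie below the size of an undecodable error. They
  form a finite set, whose maximum realises the \<open>GREATEST\<close>.\<close>

lemma omega_ge:
  assumes "1 \<le> k" and w: "\<And>e. e \<subseteq> edges k \<Longrightarrow> int (card e) \<le> w \<Longrightarrow> decodes_correctly k e"
  shows "w \<le> omega k"
proof -
  define P where "P w \<longleftrightarrow> (\<forall>e\<subseteq>edges k. int (card e) \<le> w \<longrightarrow> decodes_correctly k e)" for w :: int
  obtain e where e: "e \<subseteq> edges k" "\<not> decodes_correctly k e"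
    using undecodable_error[OF assms(1)] by blast
  have bound: "v < int (card e)" if "P v" for v
    using that e unfolding P_def by (meson linorder_not_le)
  let ?M = "{v \<in> {w..int (card e)}. P v}"
  have "P w"
    unfolding P_def using w by blast
  moreover have "finite ?M"
    by (rule finite_subset[of _ "{w..int (card e)}"]) auto
  ultimately have M: "finite ?M" "w \<in> ?M"
    using bound[of w] by simp_all
  have "omega k = Max ?M"
    unfolding omega_def P_def[symmetric]
  proof (rule Greatest_equality)
    show "P (Max ?M)"
      using Max_in[OF M(1)] M(2) by blast
    show "v \<le> Max ?M" if "P v" for v
    proof (cases "w \<le> v")
      case True
      then show ?thesis
        using M(1) bound[OF that] that by (intro Max_ge) auto
    next
      case False
      then show ?thesis
        using Max_ge[OF M] by linarith
    qed
  qed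
  then show ?thesis
    using Max_ge[OF M] by simp
qed

theorem theorem1:
  fixes k :: nat
  assumes "k \<ge> 1"
  shows "real_of_int (omega k) \<ge> (6 / 5 :: real) ^ (k - 1) - 1"
proof -
  \<comment> \<open>The largest integer strictly below the threshold of
    \<open>decodes_light_errors\<close>; rounding costs at most the 1 subtracted in the
    claim.\<close>
  let ?w = "\<lceil>(6 / 5 :: real) ^ (k - 1)\<rceil> - 1"
  have "?w \<le> omega k"
  proof (rule omega_ge[OF assms])
    fix e assume e: "e \<subseteq> edges k" "int (card e) \<le> ?w"
    then have "real (card e) < (6 / 5) ^ (k - 1)"
      by linarith
    then show "decodes_correctly k e"
      by (rule decodes_light_errors[OF assms e(1)])
  qed
  then show ?thesis
    by linarith
qed

end
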